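(* Assume the model is symmetric, i.e. $\lambda_i=\lambda$ and $|V_i|=V$ for all $i=1,\dots,K$. Assume that $\lambda<e^{-1}/V$ and that $\mathbf E[A_i(n)^{p+1}]<\infty$ for some $p\ge1$ and for all $i=1,\dots,K$ and all $n$. Assume also that $\mathsf P(A_1(1)=0,A_2(1)=0,\dots,A_K(1)=0)>0$. Then $$\lim_{n\to\infty}n^{p}\,\|\mathsf P^n(x,\cdot)-\pi(\cdot)\|=0,\qquad x\in\mathbb N^K,$$ where $\mathsf P^n(x,\cdot)$ is the distribution of $W^x(n)$ and $\pi(\cdot)$ is the stationary distribution of $W$.
   Context: Model. $\mathcal G=(\mathcal V,\mathcal E)$ is a connected undirected graph with finite vertex set $\mathcal V=\{1,\dots,K\}$. For $i\in\mathcal V$, $V_i=\{i\}\cup\{j\in\mathcal V:(i,j)\in\mathcal E\}$ is the closed neighbourhood of $i$, and $|V_i|$ is its cardinality. Time is slotted, $n=0,1,2,\dots$. The arrival vectors $A(n)=(A_1(n),\dots,A_K(n))\in\mathbb N^K$ (with $\mathbb N=\{0,1,2,\dots\}$) form an i.i.d. sequence in $n$ (coordinates may be dependent), with $\mathbf E A_i(n)=\lambda_i\in(0,\infty)$. $W_i(n)$ is the number of users at vertex $i$ at time $n$. Given $W(n)$, the numbers $N_i(n)$ of users attempting transmission are independent over $i$, $N_i(n)$ being binomial with parameters $\bigl(W_i(n),1/\sum_{j\in V_i}W_j(n)\bigr)$ (and $N_i(n)=0$ if $W_i(n)=0$), and $$W_i(n)=W_i(n-1)+A_i(n)-\mathbf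 1\{N_i(n-1)=1\}\prod_{j\in V_i\setminus\{i\}}\mathbf 1\{N_j(n-1)=0\}.$$ $W=(W(n))$ is a time-homogeneous Markov chain on $\mathbb N^K$, taken to be irreducible; $W^x$ denotes the chain with $W(0)=x$. The total variation distance is $\|\pi_1-\pi_2\|=\sup_{|g|\le1}\left|\int g\,d\pi_1-\int g\,d\pi_2\right|$. *)

theory Defs
  imports "HOL-Probability.Probability"
begin

text \<open>
  The vertices are the elements of a finite type, and a state in \<open>\<nat>\<^sup>K\<close> is a function from
  vertices to natural numbers. As the state space is countable, every function on it is
  measurable and distributions are given as probability mass functions. The i.i.d. arrival
  vectors enter through their common law \<open>\<mu>\<close>, whose coordinates may be dependent.
\<close>

type_synonym 'v state = "'v \<Rightarrow> nat"

definition connected_undirected_graph :: "('v \<times> 'v) set \<Rightarrow> bool" where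
  "connected_undirected_graph E \<longleftrightarrow> sym E \<and> (\<forall>i j. (i, j) \<in> E\<^sup>*)"

definition nbhd :: "('v \<times> 'v) set \<Rightarrow> 'v \<Rightarrow> 'v set" where
  "nbhd E i = {i} \<union> {j. (i, j) \<in> E}"

text \<open>
  If all queues in the closed neighbourhood are empty, the success parameter below is
  \<open>1 / 0 = 0\<close>; since then \<open>w i = 0\<close>, the binomial law is the point mass at \<open>0\<close> in any case.
\<close>

definition attempts :: "('v::finite \<times> 'v) set \<Rightarrow> 'v state \<Rightarrow> 'v state pmf" where
  "attempts E w =
     Pi_pmf UNIV 0 (\<lambda>i. binomial_pmf (w i) (1 / real (\<Sum>j\<in>nbhd E i. w j)))"

definition departure :: "('v::finite \<times> 'v) set \<Rightarrow> 'v state \<Rightarrow> 'v \<Rightarrow> nat" where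
  "departure E N i = of_bool (N i = 1) * (\<Prod>j\<in>nbhd E i - {i}. of_bool (N j = 0))"

text \<open>
  The truncated subtraction is exact: a departure from \<open>i\<close> requires \<open>N i = 1\<close>, and
  \<open>N i \<le> w i\<close> almost surely.
\<close>

definition step ::
    "('v::finite \<times> 'v) set \<Rightarrow> 'v state pmf \<Rightarrow> 'v state \<Rightarrow> 'v state pmf" where
  "step E \<mu> w =
     bind_pmf (attempts E w) (\<lambda>N.
     bind_pmf \<mu> (\<lambda>a.
     return_pmf (\<lambda>i. w i + a i - departure E N i)))"

text \<open>The distribution of the chain at time \<open>n\<close> when it is started in \<open>x\<close>.\<close>

primrec law ::
    "('v::finite \<times> 'v) set \<Rightarrow> 'v state pmf \<Rightarrow> 'v state \<Rightarrow> nat \<Rightarrow> 'v state pmf" where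
  "law E \<mu> x 0 = return_pmf x"
| "law E \<mu> x (Suc n) = bind_pmf (law E \<mu> x n) (step E \<mu>)"

definition irreducible_chain :: "('v::finite \<times> 'v) set \<Rightarrow> 'v state pmf \<Rightarrow> bool" where
  "irreducible_chain E \<mu> \<longleftrightarrow> (\<forall>x y. \<exists>n. pmf (law E \<mu> x n) y > 0)"

definition stationary ::
    "('v::finite \<times> 'v) set \<Rightarrow> 'v state pmf \<Rightarrow> 'v state pmf \<Rightarrow> bool" where
  "stationary E \<mu> \<pi> \<longleftrightarrow> bind_pmf \<pi> (step E \<mu>) = \<pi>"

text \<open>Normalised as twice the supremum over events, so its values lie in \<open>[0, 2]\<close>.\<close>

definition tv_dist :: "'s pmf \<Rightarrow> 's pmf \<Rightarrow> real" where
  "tv_dist p q = (SUP g\<in>{g :: 's \<Rightarrow> real. \<forall>s. \<bar>g s\<bar> \<le> 1}.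
     \<bar>measure_pmf.expectation p g - measure_pmf.expectation q g\<bar>)"

end

theory Submission
  imports Defs
begin

text \<open>
  Two independent copies of the chain are run until they meet. The quadratic form
  \<open>L(w) = \<Sum>\<^sub>i w\<^sub>i S\<^sub>i\<close> with \<open>S\<^sub>i\<close> the sum of \<open>w\<close> over \<open>V\<^sub>i\<close> has drift at most \<open>C - c \<bar>w\<bar>\<close>: up to a
  bounded error, \<open>S\<^sub>i\<close> times the departure probability at \<open>i\<close> is \<open>w\<^sub>i exp(- \<Sum>\<^sub>j w\<^sub>j / S\<^sub>j)\<close>, and
  by convexity of \<open>exp\<close> these terms sum to at least \<open>e\<^sup>-\<^sup>1 \<bar>w\<bar>\<close>. Hence \<open>sqrt (1 + L(x) + L(y))\<close>
  has increments dominated by the arrivals, and negative drift outside a finite set of pairs. In that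
  set the copies meet within a fixed number of steps with probability bounded below, as the empty
  state can be reached and has a loop; adding a bounded potential makes the drift negative up to
  the meeting time \<open>T\<close>. The \<open>(p+1)\<close>-st moments of the arrivals then bound the
  sum of \<open>n\<^sup>p P(T > n)\<close>. Applied to the starting points \<open>x\<close> and \<open>W\<^sup>x(1)\<close>, this bounds
  the sum of \<open>n\<^sup>p\<close> times the distance between the laws of \<open>W\<^sup>x(n)\<close> and \<open>W\<^sup>x(n+1)\<close>,
  so these laws are Cauchy, and their distance to the limit is \<open>o(n\<^sup>-\<^sup>p)\<close>.
\<close>

section \<open>Coupling\<close>

lemma integrable_pmf_bounded:
  fixes f :: "'a \<Rightarrow> real"
  assumes "\<And>x. \<bar>f x\<bar> \<le> B"
  shows "integrable (measure_pmf p) f"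
  using assms by (intro measure_pmf.integrable_const_bound[where B = B]) auto

lemma expectation_pmf_abs_le:
  fixes f :: "'a \<Rightarrow> real"
  assumes "\<And>x. \<bar>f x\<bar> \<le> B"
  shows "\<bar>measure_pmf.expectation p f\<bar> \<le> B"
proof -
  have "\<bar>measure_pmf.expectation p f\<bar> \<le> measure_pmf.expectation p (\<lambda>x. \<bar>f x\<bar>)"
    by (rule integral_abs_bound)
  also have "\<dots> \<le> measure_pmf.expectation p (\<lambda>_. B)"
    using assms by (intro integral_mono integrable_pmf_bounded[where B = "\<bar>B\<bar>"]) (auto intro: order_trans[OF _ abs_ge_self])
  finally show ?thesis by simp
qed

lemma expectation_bind_pmf:
  fixes f :: "'b \<Rightarrow> real"
  assumes "\<And>x. \<bar>f x\<bar> \<le> B"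
  shows "measure_pmf.expectation (bind_pmf p K) f =
    measure_pmf.expectation p (\<lambda>x. measure_pmf.expectation (K x) f)"
  unfolding measure_pmf_bind
  using assms
  by (intro integral_bind[where K = "count_space UNIV" and B = B and B' = 1])
     (auto intro: measure_pmf_in_subprob_space measurable_measure_pmf simp: measure_pmf.emeasure_space_1)

section \<open>Meeting time of two independent copies\<close>

primrec iter_pmf :: "('s \<Rightarrow> 's pmf) \<Rightarrow> 's \<Rightarrow> nat \<Rightarrow> 's pmf" where
  "iter_pmf K x 0 = return_pmf x"
| "iter_pmf K x (Suc n) = bind_pmf (iter_pmf K x n) K"

text \<open>\<open>iter_pmf\<close> appends a last step while \<open>unmet\<close> conditions on the
  first one; this exchange lets the inductions over both run in parallel.\<close>

lemma iter_pmf_Suc': "iter_pmf K x (Suc n) = bind_pmf (K x) (\<lambda>y. iter_pmf K y n)"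
proof (induction n)
  case 0
  show ?case by (simp add: bind_return_pmf bind_return_pmf')
next
  case (Suc n)
  have "iter_pmf K x (Suc (Suc n)) = bind_pmf (iter_pmf K x (Suc n)) K"
    by simp
  also have "\<dots> = bind_pmf (K x) (\<lambda>y. iter_pmf K y (Suc n))"
    unfolding Suc by (simp add: bind_assoc_pmf)
  finally show ?case .
qed

text \<open>
  The probability that two independent copies of the chain, started in \<open>x\<close> and \<open>y\<close>, have not
  been in the same state at any of the times \<open>0, \<dots>, n\<close>.
\<close>

primrec unmet :: "('s \<Rightarrow> 's pmf) \<Rightarrow> nat \<Rightarrow> 's \<Rightarrow> 's \<Rightarrow> real" where
  "unmet K 0 x y = of_bool (x \<noteq> y)"
| "unmet K (Suc n) x y = (if x = y then 0 else
     measure_pmf.expectation (pair_pmf (K x) (K y)) (\<lambda>(x', y'). unmet K n x' y'))"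

lemma unmet_bounds: "0 \<le> unmet K n x y \<and> unmet K n x y \<le> 1"
proof (induction n arbitrary: x y)
  case (Suc n)
  have "\<bar>measure_pmf.expectation (pair_pmf (K x) (K y)) (\<lambda>(x', y'). unmet K n x' y')\<bar> \<le> 1"
    using Suc by (intro expectation_pmf_abs_le) (auto simp: abs_le_iff intro: order_trans[of _ 0])
  moreover have "0 \<le> measure_pmf.expectation (pair_pmf (K x) (K y)) (\<lambda>(x', y'). unmet K n x' y')"
    using Suc by (intro integral_nonneg_AE) auto
  ultimately show ?case by auto
qed auto

lemma unmet_nonneg: "0 \<le> unmet K n x y"
  by (simp add: unmet_bounds)

lemma unmet_le_1: "unmet K n x y \<le> 1"
  by (simp add: unmet_bounds)

lemma unmet_same [simp]: "unmet K n x x = 0"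
  by (cases n) auto

lemma integrable_unmet: "integrable (measure_pmf p) (\<lambda>(x, y). unmet K n x y)"
  by (intro integrable_pmf_bounded[where B = 1]) (auto simp: abs_of_nonneg unmet_nonneg unmet_le_1)

lemma integrable_unmet': "integrable (measure_pmf p) (\<lambda>y. unmet K n x y)"
  by (intro integrable_pmf_bounded[where B = 1]) (auto simp: abs_of_nonneg unmet_nonneg unmet_le_1)

lemma expectation_pair_diff:
  fixes f :: "'a \<Rightarrow> real"
  assumes "\<And>x. \<bar>f x\<bar> \<le> B"
  shows "measure_pmf.expectation p f - measure_pmf.expectation q f =
    measure_pmf.expectation (pair_pmf p q) (\<lambda>(x, y). f x - f y)"
proof -
  have "measure_pmf.expectation (pair_pmf p q) (\<lambda>z. f (fst z) - f (snd z)) =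
      measure_pmf.expectation (pair_pmf p q) (\<lambda>z. f (fst z)) -
      measure_pmf.expectation (pair_pmf p q) (\<lambda>z. f (snd z))"
    using assms by (intro Bochner_Integration.integral_diff integrable_pmf_bounded)
  then show ?thesis
    by (simp add: case_prod_unfold)
qed

text \<open>Condition on the first step: the two expectations differ by the mean of f(x') - f(y'),
  where f is the expectation over the remaining steps, and the induction hypothesis applies inside.
  Equal starting points contribute 0 on both sides; the factor 2 is the largest possible difference
  of two values of g.\<close>

lemma coupling_inequality:
  fixes g :: "'s \<Rightarrow> real"
  assumes g: "\<And>s. \<bar>g s\<bar> \<le> 1"
  shows "\<bar>measure_pmf.expectation (iter_pmf K x n) g - measure_pmf.expectation (iter_pmf K y n) g\<bar>
    \<le> 2 * unmet K n x y"
proof (induction n arbitrary: x y)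
  case 0
  show ?case
    using g[of x] g[of y] by (auto simp: abs_le_iff)
next
  case (Suc n)
  define f where "f x = measure_pmf.expectation (iter_pmf K x n) g" for x
  have f: "\<bar>f x\<bar> \<le> 1" for x
    unfolding f_def using g by (rule expectation_pmf_abs_le)
  have E: "measure_pmf.expectation (iter_pmf K x (Suc n)) g = measure_pmf.expectation (K x) f" for x
    unfolding iter_pmf_Suc' f_def using g by (rule expectation_bind_pmf)
  have "\<bar>measure_pmf.expectation (K x) f - measure_pmf.expectation (K y) f\<bar>
      \<le> measure_pmf.expectation (pair_pmf (K x) (K y)) (\<lambda>z. \<bar>f (fst z) - f (snd z)\<bar>)"
    unfolding expectation_pair_diff[of f, OF f] by (simp add: case_prod_unfold integral_abs_bound)
  also have "\<dots> \<le> measure_pmf.expectation (pair_pmf (K x) (K y)) (\<lambda>z. 2 * (case z of (x, y) \<Rightarrow> unmet K n x y))"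
  proof (rule integral_mono)
    have "\<bar>\<bar>f (fst z) - f (snd z)\<bar>\<bar> \<le> 2" for z :: "'s \<times> 's"
      using f[of "fst z"] f[of "snd z"] by linarith
    then show "integrable (measure_pmf (pair_pmf (K x) (K y))) (\<lambda>z. \<bar>f (fst z) - f (snd z)\<bar>)"
      by (rule integrable_pmf_bounded)
    show "integrable (measure_pmf (pair_pmf (K x) (K y))) (\<lambda>z. 2 * (case z of (x, y) \<Rightarrow> unmet K n x y))"
      using integrable_unmet by (rule integrable_mult_right)
    show "\<bar>f (fst z) - f (snd z)\<bar> \<le> 2 * (case z of (x, y) \<Rightarrow> unmet K n x y)" for z
      using Suc[of "fst z" "snd z"] by (simp add: f_def case_prod_beta)
  qed
  finally show ?case
    unfolding E by auto
qed

lemma pair_pmf_expectation_mult: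
  fixes f :: "'a \<Rightarrow> real" and g :: "'b \<Rightarrow> real"
  assumes "\<And>x. \<bar>f x\<bar> \<le> B" "\<And>y. \<bar>g y\<bar> \<le> C"
  shows "measure_pmf.expectation (pair_pmf p q) (\<lambda>(x, y). f x * g y) =
    measure_pmf.expectation p f * measure_pmf.expectation q g"
proof -
  have "0 \<le> B" using assms(1)[of undefined] by linarith
  have "\<bar>f x * g y\<bar> \<le> B * C" for x y
    unfolding abs_mult using assms \<open>0 \<le> B\<close> by (intro mult_mono) auto
  then have b: "\<bar>(\<lambda>(x, y). f x * g y) z\<bar> \<le> B * C" for z
    by (auto simp: case_prod_beta)
  show ?thesis
    unfolding pair_pmf_def expectation_bind_pmf[of "\<lambda>(x, y). f x * g y", OF b]
    by simp
qed

text \<open>If both copies are at \<open>z\<close> at time n they have met, and by independence this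
  has probability equal to the product. The induction again conditions on the first step, where the
  mean of the product factorises.\<close>

lemma unmet_le:
  "unmet K n x y \<le> 1 - pmf (iter_pmf K x n) z * pmf (iter_pmf K y n) z"
proof (induction n arbitrary: x y)
  case 0
  show ?case by (auto simp: indicator_def)
next
  case (Suc n)
  define f where "f x = pmf (iter_pmf K x n) z" for x
  have f: "\<bar>f x\<bar> \<le> 1" for x by (simp add: f_def pmf_le_1)
  have ff: "\<bar>f x * f y\<bar> \<le> 1" for x y
    unfolding abs_mult using f[of x] f[of y] by (simp add: mult_le_one)
  have E: "pmf (iter_pmf K x (Suc n)) z = measure_pmf.expectation (K x) f" for x
    unfolding iter_pmf_Suc' f_def pmf_bind ..
  have int: "integrable (pair_pmf (K x) (K y)) (\<lambda>(x, y). f x * f y)"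
    using ff by (intro integrable_pmf_bounded[where B = 1]) auto
  show ?case
  proof (cases "x = y")
    case True
    then show ?thesis by (simp add: pmf_le_1 mult_le_one)
  next
    case False
    then have "unmet K (Suc n) x y = measure_pmf.expectation (pair_pmf (K x) (K y)) (\<lambda>(x', y'). unmet K n x' y')"
      by simp
    also have "\<dots> \<le> measure_pmf.expectation (pair_pmf (K x) (K y)) (\<lambda>z. 1 - (case z of (x, y) \<Rightarrow> f x * f y))"
      using Suc by (intro integral_mono integrable_unmet Bochner_Integration.integrable_diff int) (auto simp: f_def)
    also have "\<dots> = 1 - measure_pmf.expectation (K x) f * measure_pmf.expectation (K y) f"
      by (subst Bochner_Integration.integral_diff[OF _ int]) (auto simp: pair_pmf_expectation_mult[OF f f])
    finally show ?thesis unfolding E .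
  qed
qed

text \<open>
  The drift condition says that \<open>(G(X\<^sub>n, Y\<^sub>n) + \<epsilon> n)\<^sup>p\<^sup>+\<^sup>1\<close> is a supermartingale up to the meeting
  time, with a gain of \<open>c\<close> times the \<open>p\<close>-th power in every step.
\<close>

lemma unmet_weighted_sum:
  fixes G :: "'s \<Rightarrow> 's \<Rightarrow> real"
  assumes pos: "0 \<le> p" "0 \<le> c" "0 \<le> \<epsilon>" and G: "\<And>x y. 0 \<le> G x y"
    and int: "\<And>x y m. x \<noteq> y \<Longrightarrow> 0 \<le> m \<Longrightarrow>
      integrable (pair_pmf (K x) (K y)) (\<lambda>(x', y'). (G x' y' + m + \<epsilon>) powr (p + 1))"
    and drift: "\<And>x y m. x \<noteq> y \<Longrightarrow> 0 \<le> m \<Longrightarrow>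
      measure_pmf.expectation (pair_pmf (K x) (K y)) (\<lambda>(x', y'). (G x' y' + m + \<epsilon>) powr (p + 1))
        \<le> (G x y + m) powr (p + 1) - c * (G x y + m) powr p"
    and m: "0 \<le> m"
  shows "c * (\<Sum>n<N. (\<epsilon> * real n + m) powr p * unmet K n x y) \<le> (G x y + m) powr (p + 1)"
  using m
proof (induction N arbitrary: x y m)
  case 0
  show ?case by simp
next
  case (Suc N)
  show ?case
  proof (cases "x = y")
    case True
    then show ?thesis by simp
  next
    case False
    let ?P = "measure_pmf (pair_pmf (K x) (K y))"
    have "c * (\<Sum>n<N. (\<epsilon> * real (Suc n) + m) powr p * unmet K (Suc n) x y) =
        (\<integral>z. c * (\<Sum>n<N. (\<epsilon> * real n + (m + \<epsilon>)) powr p * (case z of (x', y') \<Rightarrow> unmet K n x' y')) \<partial>?P)"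
      using False
      by (subst integral_mult_right_zero, subst Bochner_Integration.integral_sum)
         (auto intro!: integrable_mult_right integrable_unmet simp: algebra_simps)
    also have "\<dots> \<le> (\<integral>z. (case z of (x', y') \<Rightarrow> (G x' y' + m + \<epsilon>) powr (p + 1)) \<partial>?P)"
    proof (rule integral_mono)
      show "integrable ?P (\<lambda>z. c * (\<Sum>n<N. (\<epsilon> * real n + (m + \<epsilon>)) powr p * (case z of (x', y') \<Rightarrow> unmet K n x' y')))"
        using integrable_unmet by (intro integrable_mult_right Bochner_Integration.integrable_sum)
      show "integrable ?P (\<lambda>(x', y'). (G x' y' + m + \<epsilon>) powr (p + 1))"
        using int False Suc.prems by blast
      \<comment> \<open>The offset \<open>m\<close> is the clock: after one step the induction
        hypothesis is used at the new pair with the clock advanced by \<epsilon>.\<close>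
      show "c * (\<Sum>n<N. (\<epsilon> * real n + (m + \<epsilon>)) powr p * (case z of (x', y') \<Rightarrow> unmet K n x' y'))
          \<le> (case z of (x', y') \<Rightarrow> (G x' y' + m + \<epsilon>) powr (p + 1))" for z
        using Suc.IH[of "m + \<epsilon>" "fst z" "snd z"] Suc.prems pos by (simp add: case_prod_beta add.assoc)
    qed
    also have "\<dots> \<le> (G x y + m) powr (p + 1) - c * (G x y + m) powr p"
      using drift False Suc.prems by blast
    finally have 1: "c * (\<Sum>n<N. (\<epsilon> * real (Suc n) + m) powr p * unmet K (Suc n) x y)
      \<le> (G x y + m) powr (p + 1) - c * (G x y + m) powr p" .
    \<comment> \<open>The gain granted by the drift condition in this step pays for the summand at n
      = 0, where \<open>unmet\<close> is 1.\<close>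
    have "m powr p \<le> (G x y + m) powr p"
      using Suc.prems G pos by (intro powr_mono2) auto
    then have 2: "c * m powr p \<le> c * (G x y + m) powr p"
      using pos by (intro mult_left_mono)
    have "c * (\<Sum>n<Suc N. (\<epsilon> * real n + m) powr p * unmet K n x y) =
      c * m powr p + c * (\<Sum>n<N. (\<epsilon> * real (Suc n) + m) powr p * unmet K (Suc n) x y)"
      using False by (simp only: sum.lessThan_Suc_shift) (simp add: distrib_left)
    then show ?thesis using 1 2 by linarith
  qed
qed

section \<open>Limits and distances of distributions\<close>

lemma expectation_count_space:
  fixes g :: "'a \<Rightarrow> real"
  shows "measure_pmf.expectation p g = (\<integral>x. pmf p x * g x \<partial>count_space UNIV)"
  unfolding measure_pmf_eq_density by (subst integral_density) auto

lemma integrable_pmf_mult_bounded: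
  fixes g :: "'a \<Rightarrow> real"
  assumes "\<And>x. \<bar>g x\<bar> \<le> 1"
  shows "integrable (count_space UNIV) (\<lambda>x. pmf p x * g x)"
  using integrable_pmf[of UNIV p]
  by (rule Bochner_Integration.integrable_bound) (auto simp: abs_mult assms mult_left_le)

lemma expectation_indicator_pmf: "measure_pmf.expectation p (indicator {x}) = pmf p x"
  by (simp add: measure_pmf_single)

text \<open>Summability of the distances gives more than pointwise convergence of the mass
  functions: they are all dominated by one integrable function, so no mass escapes and expectations
  of bounded functions converge by dominated convergence.\<close>

lemma pmf_Cauchy_limit:
  fixes a :: "nat \<Rightarrow> 'a pmf"
  assumes a: "\<And>n (g :: 'a \<Rightarrow> real). (\<And>s. \<bar>g s\<bar> \<le> 1) \<Longrightarrow>
      \<bar>measure_pmf.expectation (a n) g - measure_pmf.expectation (a (Suc n)) g\<bar> \<le> e n"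
    and e: "summable e"
  shows "\<exists>\<pi>. \<forall>g :: 'a \<Rightarrow> real. (\<forall>s. \<bar>g s\<bar> \<le> 1) \<longrightarrow>
    (\<lambda>n. measure_pmf.expectation (a n) g) \<longlonglongrightarrow> measure_pmf.expectation \<pi> g"
proof -
  define d where "d n x = pmf (a (Suc n)) x - pmf (a n) x" for n x
  have d_le: "\<bar>d n x\<bar> \<le> e n" for n x
    using a[of "indicator {x}" n] by (auto simp: d_def expectation_indicator_pmf indicator_def abs_minus_commute measure_pmf_single)
  have sd: "summable (\<lambda>n. \<bar>d n x\<bar>)" for x
    using e by (rule summable_comparison_test'[where N = 0]) (simp add: d_le)
  have int_d: "integrable (count_space UNIV) (d n)" for n
    unfolding d_def by (intro Bochner_Integration.integrable_diff integrable_pmf)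
  have e_nonneg: "0 \<le> e n" for n
    using d_le[of n undefined] by linarith
  have norm_d: "(\<integral>x. \<bar>d n x\<bar> \<partial>count_space UNIV) \<le> e n" for n
  proof -
    \<comment> \<open>Testing with the sign of the difference turns the bound on expectations into a
      bound on the l1 norm.\<close>
    define s where "s x = sgn (d n x)" for x
    have s: "\<bar>s x\<bar> \<le> 1" for x by (simp add: s_def sgn_if)
    have "(\<integral>x. \<bar>d n x\<bar> \<partial>count_space UNIV) =
      (\<integral>x. pmf (a (Suc n)) x * s x - pmf (a n) x * s x \<partial>count_space UNIV)"
      by (rule Bochner_Integration.integral_cong) (auto simp: s_def d_def sgn_if)
    also have "\<dots> = measure_pmf.expectation (a (Suc n)) s - measure_pmf.expectation (a n) s"
      unfolding expectation_count_space
      using s by (intro Bochner_Integration.integral_diff integrable_pmf_mult_bounded)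
    also have "\<dots> \<le> e n"
      using a[of s n, OF s] by linarith
    finally show ?thesis .
  qed
  \<comment> \<open>The dominating function: the first mass function plus all absolute increments,
    integrable because the l1 norms of the increments are summable.\<close>
  define w where "w x = pmf (a 0) x + (\<Sum>n. \<bar>d n x\<bar>)" for x
  have int_w: "integrable (count_space UNIV) w"
    unfolding w_def
  proof (intro Bochner_Integration.integrable_add integrable_pmf integrable_suminf)
    show "integrable (count_space UNIV) (\<lambda>x. \<bar>d n x\<bar>)" for n
      using int_d by (rule integrable_abs)
    show "AE x in count_space UNIV. summable (\<lambda>n. norm \<bar>d n x\<bar>)"
      using sd by auto
    show "summable (\<lambda>n. \<integral>x. norm \<bar>d n x\<bar> \<partial>count_space UNIV)"
      using e by (rule summable_comparison_test'[where N = 0]) (auto simp: norm_d integral_nonneg_AE abs_of_nonneg)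
  qed
  have tele: "pmf (a n) x = pmf (a 0) x + (\<Sum>k<n. d k x)" for n x
    by (induction n) (auto simp: d_def)
  define L where "L x = pmf (a 0) x + (\<Sum>k. d k x)" for x
  have lim: "(\<lambda>n. pmf (a n) x) \<longlonglongrightarrow> L x" for x
  proof (rule Lim_transform_eventually)
    show "(\<lambda>n. pmf (a 0) x + (\<Sum>k<n. d k x)) \<longlonglongrightarrow> L x"
      unfolding L_def using summable_rabs_cancel[OF sd] by (intro tendsto_intros summable_LIMSEQ)
  qed (simp add: tele[symmetric])
  have bd: "pmf (a n) x \<le> w x" for n x
  proof -
    have "(\<Sum>k<n. d k x) \<le> (\<Sum>k<n. \<bar>d k x\<bar>)" by (intro sum_mono) auto
    also have "\<dots> \<le> (\<Sum>k. \<bar>d k x\<bar>)" using sd by (intro sum_le_suminf) auto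
    finally show ?thesis unfolding w_def tele[of n] by simp
  qed
  have conv: "integrable (count_space UNIV) (\<lambda>x. L x * g x)"
      "(\<lambda>n. measure_pmf.expectation (a n) g) \<longlonglongrightarrow> (\<integral>x. L x * g x \<partial>count_space UNIV)"
    if g: "\<And>s. \<bar>g s\<bar> \<le> 1" for g :: "'a \<Rightarrow> real"
  proof -
    have 1: "AE x in count_space UNIV. (\<lambda>n. pmf (a n) x * g x) \<longlonglongrightarrow> L x * g x"
      by (auto intro!: tendsto_intros lim)
    have 2: "AE x in count_space UNIV. norm (pmf (a n) x * g x) \<le> w x" for n
      using g bd[of n] by (auto simp: abs_mult intro!: order_trans[OF mult_left_le])
    show "integrable (count_space UNIV) (\<lambda>x. L x * g x)"
      by (rule integrable_dominated_convergence[OF _ _ int_w 1 2]) auto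
    show "(\<lambda>n. measure_pmf.expectation (a n) g) \<longlonglongrightarrow> (\<integral>x. L x * g x \<partial>count_space UNIV)"
      unfolding expectation_count_space
      by (rule integral_dominated_convergence[OF _ _ int_w 1 2]) auto
  qed
  have L0: "0 \<le> L x" for x
    using lim by (rule LIMSEQ_le_const) auto
  \<comment> \<open>The test function 1 shows that the limit has total mass 1, as
    \<open>embed_pmf\<close> requires.\<close>
  have "(\<lambda>n. measure_pmf.expectation (a n) (\<lambda>_. 1)) \<longlonglongrightarrow> (\<integral>x. L x * 1 \<partial>count_space UNIV)"
    by (rule conv) simp
  then have "(\<integral>x. L x \<partial>count_space UNIV) = 1"
    by (simp add: LIMSEQ_const_iff)
  moreover have "integrable (count_space UNIV) L"
    using conv(1)[of "\<lambda>_. 1"] by simp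
  ultimately have "(\<integral>\<^sup>+x. ennreal (L x) \<partial>count_space UNIV) = 1"
    by (subst nn_integral_eq_integral) (auto simp: L0)
  then have "pmf (embed_pmf L) x = L x" for x
    using L0 by (intro pmf_embed_pmf)
  then have "(\<integral>x. L x * g x \<partial>count_space UNIV) = measure_pmf.expectation (embed_pmf L) g" for g
    by (simp add: expectation_count_space)
  then show ?thesis
    using conv(2) by (intro exI[of _ "embed_pmf L"]) simp
qed

lemma pmf_eq_if_expectation_eq:
  fixes p q :: "'a pmf"
  assumes "\<And>g :: 'a \<Rightarrow> real. (\<And>s. \<bar>g s\<bar> \<le> 1) \<Longrightarrow> measure_pmf.expectation p g = measure_pmf.expectation q g"
  shows "p = q"
proof (rule pmf_eqI)
  fix x
  show "pmf p x = pmf q x"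
    using assms[of "indicator {x}"] by (simp add: measure_pmf_single indicator_def)
qed

lemma tv_dist_le:
  fixes p q :: "'a pmf"
  assumes "\<And>g :: 'a \<Rightarrow> real. (\<And>s. \<bar>g s\<bar> \<le> 1) \<Longrightarrow> \<bar>measure_pmf.expectation p g - measure_pmf.expectation q g\<bar> \<le> B"
  shows "tv_dist p q \<le> B"
  unfolding tv_dist_def using assms by (intro cSUP_least) (auto intro!: exI[of _ "\<lambda>_. 0"])

text \<open>The supremum is taken in the reals, so the family has to be bounded, here by 2, before
  the zero function can witness the lower bound.\<close>

lemma tv_dist_nonneg:
  fixes p q :: "'a pmf"
  shows "0 \<le> tv_dist p q"
proof -
  have "bdd_above ((\<lambda>g. \<bar>measure_pmf.expectation p g - measure_pmf.expectation q g\<bar>) ` {g :: 'a \<Rightarrow> real. \<forall>s. \<bar>g s\<bar> \<le> 1})"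
  proof (rule bdd_aboveI[where M = 2])
    fix z assume "z \<in> (\<lambda>g. \<bar>measure_pmf.expectation p g - measure_pmf.expectation q g\<bar>) ` {g :: 'a \<Rightarrow> real. \<forall>s. \<bar>g s\<bar> \<le> 1}"
    then obtain g :: "'a \<Rightarrow> real" where z: "z = \<bar>measure_pmf.expectation p g - measure_pmf.expectation q g\<bar>"
      and g: "\<And>s. \<bar>g s\<bar> \<le> 1"
      by auto
    show "z \<le> 2"
      using expectation_pmf_abs_le[of g 1 p, OF g] expectation_pmf_abs_le[of g 1 q, OF g] unfolding z by linarith
  qed
  then show ?thesis
    unfolding tv_dist_def by (rule cSUP_upper2[where x = "\<lambda>_. 0"]) auto
qed

section \<open>From meeting times to convergence rates\<close>

lemma bind_iter_pmf_stationary: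
  assumes "bind_pmf \<pi> K = \<pi>"
  shows "bind_pmf \<pi> (\<lambda>y. iter_pmf K y n) = \<pi>"
proof (induction n)
  case (Suc n)
  have "bind_pmf \<pi> (\<lambda>y. iter_pmf K y (Suc n)) = bind_pmf (bind_pmf \<pi> (\<lambda>y. iter_pmf K y n)) K"
    by (simp add: bind_assoc_pmf)
  then show ?case using Suc assms by simp
qed (simp add: bind_return_pmf')

text \<open>The coupling inequality integrated over a random start of the second copy. It serves
  twice: with the start drawn from \<open>K x\<close>, which yields the law one step later, and with
  the start drawn from a stationary law.\<close>

lemma coupling_inequality_mixture:
  fixes g :: "'s \<Rightarrow> real"
  assumes g: "\<And>s. \<bar>g s\<bar> \<le> 1"
  shows "\<bar>measure_pmf.expectation (iter_pmf K x n) g -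
      measure_pmf.expectation (bind_pmf \<pi> (\<lambda>y. iter_pmf K y n)) g\<bar>
    \<le> 2 * measure_pmf.expectation \<pi> (unmet K n x)"
proof -
  define f where "f x = measure_pmf.expectation (iter_pmf K x n) g" for x
  have f: "\<bar>f x\<bar> \<le> 1" for x
    unfolding f_def using g by (rule expectation_pmf_abs_le)
  have "\<bar>f x - measure_pmf.expectation \<pi> f\<bar> = \<bar>measure_pmf.expectation \<pi> (\<lambda>y. f x - f y)\<bar>"
    by (subst Bochner_Integration.integral_diff) (auto intro!: integrable_pmf_bounded[where B = 1] f)
  also have "\<dots> \<le> measure_pmf.expectation \<pi> (\<lambda>y. \<bar>f x - f y\<bar>)"
    by (rule integral_abs_bound)
  also have "\<dots> \<le> measure_pmf.expectation \<pi> (\<lambda>y. 2 * unmet K n x y)"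
  proof (rule integral_mono)
    have "\<bar>\<bar>f x - f y\<bar>\<bar> \<le> 2" for y
      using f[of x] f[of y] by linarith
    then show "integrable (measure_pmf \<pi>) (\<lambda>y. \<bar>f x - f y\<bar>)"
      by (rule integrable_pmf_bounded)
    show "integrable (measure_pmf \<pi>) (\<lambda>y. 2 * unmet K n x y)"
      by (intro integrable_mult_right integrable_unmet')
    show "\<bar>f x - f y\<bar> \<le> 2 * unmet K n x y" for y
      unfolding f_def using g by (rule coupling_inequality)
  qed
  finally show ?thesis
    unfolding expectation_bind_pmf[of g, OF g] f_def[symmetric] by simp
qed

lemma suminf_tail_tendsto_0:
  fixes f :: "nat \<Rightarrow> real"
  assumes "summable f"
  shows "(\<lambda>n. \<Sum>k. f (k + n)) \<longlonglongrightarrow> 0"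
proof -
  have "(\<lambda>n. suminf f - sum f {..<n}) \<longlonglongrightarrow> suminf f - suminf f"
    using assms by (intro tendsto_intros summable_LIMSEQ)
  then show ?thesis
    using suminf_minus_initial_segment[OF assms] by simp
qed

text \<open>The rate comes from comparing the laws at times n and n + 1, that is, from the starts x
  and one step of the chain from x. This way only the law \<open>K x\<close> of a single step has to
  be integrated, and the distance to the limit is a tail of a summable series.\<close>

theorem polynomial_ergodicity_of_unmet:
  fixes K :: "'s \<Rightarrow> 's pmf"
  assumes p: "0 \<le> p"
    and bounded: "\<And>x. \<exists>C. \<forall>N. (\<Sum>n<N. real n powr p * measure_pmf.expectation (K x) (unmet K n x)) \<le> C"
    and unmet: "\<And>x y. (\<lambda>n. unmet K n x y) \<longlonglongrightarrow> 0"
  shows "\<exists>!\<pi>. bind_pmf \<pi> K = \<pi>"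
    and "bind_pmf \<pi> K = \<pi> \<Longrightarrow> (\<lambda>n. real n powr p * tv_dist (iter_pmf K x n) \<pi>) \<longlonglongrightarrow> 0"
proof -
  define e where "e x n = 2 * measure_pmf.expectation (K x) (unmet K n x)" for x n
  have e_nonneg: "0 \<le> e x n" for x n
    by (simp add: e_def unmet_nonneg integral_nonneg_AE)
  have e: "\<bar>measure_pmf.expectation (iter_pmf K x n) g - measure_pmf.expectation (iter_pmf K x (Suc n)) g\<bar> \<le> e x n"
    if "\<And>s. \<bar>g s\<bar> \<le> 1" for x n g
    using coupling_inequality_mixture[OF that] by (simp add: iter_pmf_Suc' e_def del: iter_pmf.simps)
  have sum_pe: "summable (\<lambda>n. real n powr p * e x n)" for x
  proof -
    obtain C where C: "\<And>N. (\<Sum>n<N. real n powr p * measure_pmf.expectation (K x) (unmet K n x)) \<le> C"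
      using bounded[of x] by auto
    show ?thesis
    proof (rule summableI_nonneg_bounded)
      show "(\<Sum>n<N. real n powr p * e x n) \<le> 2 * C" for N
        using mult_left_mono[OF C[of N], of 2] by (simp add: e_def sum_distrib_left mult.left_commute)
    qed (simp add: e_nonneg)
  qed
  \<comment> \<open>The comparison begins at n = 1 because \<open>0 powr p\<close> is 0.\<close>
  have sum_e: "summable (e x)" for x
  proof (rule summable_comparison_test'[where N = 1])
    show "norm (e x n) \<le> real n powr p * e x n" if "n \<ge> 1" for n
    proof -
      have "1 \<le> real n powr p" using that p by (intro ge_one_powr_ge_zero) auto
      then show ?thesis using e_nonneg[of x n] mult_right_mono[of 1 "real n powr p" "e x n"] by simp
    qed
  qed (rule sum_pe)
  \<comment> \<open>Convergence to any stationary law, without a rate, by dominated convergence over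
    the starting point. It gives uniqueness and identifies the limit in the rate estimate.\<close>
  have to_stationary: "(\<lambda>n. measure_pmf.expectation (iter_pmf K x n) g) \<longlonglongrightarrow> measure_pmf.expectation \<pi> g"
    if \<pi>: "bind_pmf \<pi> K = \<pi>" and g: "\<And>s. \<bar>g s\<bar> \<le> 1" for \<pi> x and g :: "'s \<Rightarrow> real"
  proof -
    have "(\<lambda>n. measure_pmf.expectation \<pi> (unmet K n x)) \<longlonglongrightarrow> measure_pmf.expectation \<pi> (\<lambda>_. 0)"
      by (rule integral_dominated_convergence[where w = "\<lambda>_. 1"]) (auto simp: unmet unmet_nonneg unmet_le_1 abs_of_nonneg)
    then have "(\<lambda>n. 2 * measure_pmf.expectation \<pi> (unmet K n x)) \<longlonglongrightarrow> 0"
      by (auto dest: tendsto_mult_left[of _ _ _ 2])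
    then have "(\<lambda>n. measure_pmf.expectation (iter_pmf K x n) g - measure_pmf.expectation \<pi> g) \<longlonglongrightarrow> 0"
      by (rule Lim_null_comparison[rotated])
         (use coupling_inequality_mixture[OF g, where K = K and x = x and \<pi> = \<pi>] bind_iter_pmf_stationary[OF \<pi>] in auto)
    then show ?thesis by (simp add: LIM_zero_iff)
  qed
  show "\<exists>!\<pi>. bind_pmf \<pi> K = \<pi>"
  proof (rule ex_ex1I)
    fix x :: 's
    have "\<exists>\<pi>. \<forall>g :: 's \<Rightarrow> real. (\<forall>s. \<bar>g s\<bar> \<le> 1) \<longrightarrow>
        (\<lambda>n. measure_pmf.expectation (iter_pmf K x n) g) \<longlonglongrightarrow> measure_pmf.expectation \<pi> g"
      using e sum_e by (rule pmf_Cauchy_limit)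
    then obtain \<pi> where \<pi>: "(\<lambda>n. measure_pmf.expectation (iter_pmf K x n) g) \<longlonglongrightarrow> measure_pmf.expectation \<pi> g"
      if "\<And>s. \<bar>g s\<bar> \<le> 1" for g :: "'s \<Rightarrow> real"
      by auto
    have "bind_pmf \<pi> K = \<pi>"
    proof (rule pmf_eq_if_expectation_eq)
      fix g :: "'s \<Rightarrow> real" assume g: "\<And>s. \<bar>g s\<bar> \<le> 1"
      \<comment> \<open>One step of \<open>K\<close> maps bounded test functions to bounded ones, so
        the limit of the expectations at time n + 1 can be computed in two ways; equating them is
        stationarity.\<close>
      define f where "f x = measure_pmf.expectation (K x) g" for x
      have f: "\<bar>f x\<bar> \<le> 1" for x
        unfolding f_def using g by (rule expectation_pmf_abs_le)
      have "(\<lambda>n. measure_pmf.expectation (iter_pmf K x (Suc n)) g) \<longlonglongrightarrow> measure_pmf.expectation (bind_pmf \<pi> K) g"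
        using \<pi>[of f, OF f] by (simp add: expectation_bind_pmf[of g, OF g] f_def[abs_def])
      moreover have "(\<lambda>n. measure_pmf.expectation (iter_pmf K x (Suc n)) g) \<longlonglongrightarrow> measure_pmf.expectation \<pi> g"
        using \<pi>[of g, OF g] by (rule LIMSEQ_Suc)
      ultimately show "measure_pmf.expectation (bind_pmf \<pi> K) g = measure_pmf.expectation \<pi> g"
        by (rule LIMSEQ_unique)
    qed
    then show "\<exists>\<pi>. bind_pmf \<pi> K = \<pi>" by blast
  next
    fix \<pi> \<pi>' assume \<pi>: "bind_pmf \<pi> K = \<pi>" "bind_pmf \<pi>' K = \<pi>'"
    show "\<pi> = \<pi>'"
    proof (rule pmf_eq_if_expectation_eq)
      fix g :: "'s \<Rightarrow> real" assume g: "\<And>s. \<bar>g s\<bar> \<le> 1"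
      show "measure_pmf.expectation \<pi> g = measure_pmf.expectation \<pi>' g"
        by (rule LIMSEQ_unique[OF to_stationary[OF \<pi>(1) g] to_stationary[OF \<pi>(2) g]])
    qed
  qed
  show "(\<lambda>n. real n powr p * tv_dist (iter_pmf K x n) \<pi>) \<longlonglongrightarrow> 0" if \<pi>: "bind_pmf \<pi> K = \<pi>"
  proof (rule Lim_null_comparison)
    show "(\<lambda>n. \<Sum>k. real (k + n) powr p * e x (k + n)) \<longlonglongrightarrow> 0"
      using sum_pe by (rule suminf_tail_tendsto_0)
    show "\<forall>\<^sub>F n in sequentially. norm (real n powr p * tv_dist (iter_pmf K x n) \<pi>)
        \<le> (\<Sum>k. real (k + n) powr p * e x (k + n))"
    proof (intro always_eventually allI)
      fix n
      have "tv_dist (iter_pmf K x n) \<pi> \<le> (\<Sum>k. e x (k + n))"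
      proof (rule tv_dist_le)
        fix g :: "'s \<Rightarrow> real" assume g: "\<And>s. \<bar>g s\<bar> \<le> 1"
        \<comment> \<open>Telescoping over m steps with a bound uniform in m; then m tends to
          infinity with n fixed.\<close>
        have partial: "\<bar>measure_pmf.expectation (iter_pmf K x n) g - measure_pmf.expectation (iter_pmf K x (m + n)) g\<bar>
            \<le> (\<Sum>k<m. e x (k + n))" for m
        proof (induction m)
          case (Suc m)
          have "\<bar>measure_pmf.expectation (iter_pmf K x (m + n)) g - measure_pmf.expectation (iter_pmf K x (Suc m + n)) g\<bar> \<le> e x (m + n)"
            using e[OF g, of x "m + n"] by simp
          then show ?case
            using Suc unfolding sum.lessThan_Suc by linarith
        qed simp
        have "(\<Sum>k<m. e x (k + n)) \<le> (\<Sum>k. e x (k + n))" for m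
          using sum_e e_nonneg by (intro sum_le_suminf) (auto simp: summable_iff_shift)
        then have "\<bar>measure_pmf.expectation (iter_pmf K x n) g - measure_pmf.expectation (iter_pmf K x (m + n)) g\<bar>
            \<le> (\<Sum>k. e x (k + n))" for m
          using partial[of m] by (rule order_trans[rotated])
        moreover have "(\<lambda>m. \<bar>measure_pmf.expectation (iter_pmf K x n) g - measure_pmf.expectation (iter_pmf K x (m + n)) g\<bar>)
            \<longlonglongrightarrow> \<bar>measure_pmf.expectation (iter_pmf K x n) g - measure_pmf.expectation \<pi> g\<bar>"
          using to_stationary[OF \<pi> g, of x] by (intro tendsto_intros LIMSEQ_ignore_initial_segment)
        ultimately show "\<bar>measure_pmf.expectation (iter_pmf K x n) g - measure_pmf.expectation \<pi> g\<bar> \<le> (\<Sum>k. e x (k + n))"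
          by (intro LIMSEQ_le_const2) auto
      qed
      then have "real n powr p * tv_dist (iter_pmf K x n) \<pi> \<le> real n powr p * (\<Sum>k. e x (k + n))"
        by (intro mult_left_mono) auto
      also have "\<dots> = (\<Sum>k. real n powr p * e x (k + n))"
        using sum_e by (intro suminf_mult[symmetric]) (auto simp: summable_iff_shift)
      \<comment> \<open>The weight at n is at most the weight at k + n, so it may be moved inside
        the tail.\<close>
      also have "\<dots> \<le> (\<Sum>k. real (k + n) powr p * e x (k + n))"
      proof (rule suminf_le)
        show "real n powr p * e x (k + n) \<le> real (k + n) powr p * e x (k + n)" for k
          using p e_nonneg by (intro mult_right_mono powr_mono2) auto
        show "summable (\<lambda>k. real n powr p * e x (k + n))"
          using sum_e by (intro summable_mult) (auto simp: summable_iff_shift)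
        show "summable (\<lambda>k. real (k + n) powr p * e x (k + n))"
          using sum_pe[of x] summable_iff_shift[of "\<lambda>k. real k powr p * e x k" n] by simp
      qed
      finally show "norm (real n powr p * tv_dist (iter_pmf K x n) \<pi>)
          \<le> (\<Sum>k. real (k + n) powr p * e x (k + n))"
        by (simp add: tv_dist_nonneg)
    qed
  qed
qed

section \<open>Drift\<close>

text \<open>Mean value theorem: the derivative at the intermediate point differs from that at
  \<open>y\<close> by at most its growth up to \<open>y + b\<close>. The error is written with
  \<open>y powr p\<close> factored out because the remaining factor tends to 0 as \<open>y\<close>
  grows.\<close>

lemma powr_add_one_increment:
  fixes p y d b :: real
  assumes p: "1 \<le> p" and y: "0 < y" and yd: "0 < y + d" and d: "\<bar>d\<bar> \<le> b"
  shows "(y + d) powr (p + 1) \<le> y powr (p + 1) + (p + 1) * y powr p * (d + b * ((1 + b / y) powr p - 1))"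
proof -
  have deriv: "((\<lambda>x. x powr (p + 1)) has_real_derivative (p + 1) * x powr p) (at x)" if "0 < x" for x
    using that by (auto intro!: derivative_eq_intros)
  have b0: "0 \<le> b" using d by linarith
  obtain z t where z: "z = y + t" "\<bar>t\<bar> \<le> \<bar>d\<bar>" "0 < z"
    and mvt: "(y + d) powr (p + 1) = y powr (p + 1) + (p + 1) * (d * z powr p)"
  proof (cases d "0 :: real" rule: linorder_cases)
    case less
    then obtain z where "y + d < z" "z < y"
      "y powr (p + 1) - (y + d) powr (p + 1) = (y - (y + d)) * ((p + 1) * z powr p)"
      using MVT2[of "y + d" y "\<lambda>x. x powr (p + 1)" "\<lambda>x. (p + 1) * x powr p"] deriv yd by auto
    then show thesis
      using less yd by (intro that[of z "z - y"]) (auto simp: algebra_simps)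
  next
    case equal
    then show thesis using y by (intro that[of y 0]) auto
  next
    case greater
    then obtain z where "y < z" "z < y + d"
      "(y + d) powr (p + 1) - y powr (p + 1) = (y + d - y) * ((p + 1) * z powr p)"
      using MVT2[of y "y + d" "\<lambda>x. x powr (p + 1)" "\<lambda>x. (p + 1) * x powr p"] deriv y by auto
    then show thesis
      using greater y by (intro that[of z "z - y"]) (auto simp: algebra_simps)
  qed
  have scale: "(y + b) powr p - y powr p = y powr p * ((1 + b / y) powr p - 1)"
  proof -
    have "(y + b) powr p = (y * (1 + b / y)) powr p" using y by (simp add: distrib_left)
    also have "\<dots> = y powr p * (1 + b / y) powr p" by (rule powr_mult)
    finally show ?thesis by (simp add: algebra_simps)
  qed
  have "\<bar>z powr p - y powr p\<bar> \<le> (y + b) powr p - y powr p"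
  proof (cases "0 \<le> t")
    case True
    have "z powr p \<le> (y + b) powr p" using p z d True y by (intro powr_mono2) auto
    moreover have "y powr p \<le> z powr p" using p z True y by (intro powr_mono2) auto
    ultimately show ?thesis by linarith
  next
    case False
    \<comment> \<open>\<open>y\<close> is the midpoint of \<open>z\<close> and its mirror image
      \<open>y - t\<close>. Convexity bounds the loss below \<open>y\<close> by the gain above it,
      so one bound covers both signs of \<open>t\<close>.\<close>
    have "(1/2 * z + 1/2 * (y - t)) powr p \<le> 1/2 * z powr p + 1/2 * (y - t) powr p"
      using convex_onD[OF powr_convex[OF p], of "1/2" z "y - t"] z y False by (simp add: algebra_simps)
    moreover have "1/2 * z + 1/2 * (y - t) = y" using z by (simp add: field_simps)
    ultimately have "2 * y powr p \<le> z powr p + (y - t) powr p" by simp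
    moreover have "(y - t) powr p \<le> (y + b) powr p"
      using p z d False y by (intro powr_mono2) auto
    moreover have "z powr p \<le> y powr p" using p z False y by (intro powr_mono2) auto
    ultimately show ?thesis by linarith
  qed
  then have "\<bar>d\<bar> * \<bar>z powr p - y powr p\<bar> \<le> b * (y powr p * ((1 + b / y) powr p - 1))"
    using d b0 unfolding scale by (intro mult_mono) auto
  moreover have "d * (z powr p - y powr p) \<le> \<bar>d\<bar> * \<bar>z powr p - y powr p\<bar>"
    by (metis abs_ge_self abs_mult)
  ultimately have "d * z powr p \<le> y powr p * (d + b * ((1 + b / y) powr p - 1))"
    by (simp add: algebra_simps)
  then have "(p + 1) * (d * z powr p) \<le> (p + 1) * (y powr p * (d + b * ((1 + b / y) powr p - 1)))"
    using p by (intro mult_left_mono) auto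
  then show ?thesis unfolding mvt by (simp add: mult.assoc)
qed

text \<open>The second bound supplies the dominating function for the limit in \<open>y\<close>; the
  third, monotonicity in \<open>y\<close>, carries an estimate from one value of \<open>y\<close> to
  all larger ones.\<close>

lemma increment_excess_bounds:
  fixes p b y y' :: real
  assumes p: "1 \<le> p" and b: "0 \<le> b" and y: "1 \<le> y" "y \<le> y'"
  shows "0 \<le> b * ((1 + b / y) powr p - 1)"
    and "b * ((1 + b / y) powr p - 1) \<le> (1 + b) powr (p + 1)"
    and "b * ((1 + b / y') powr p - 1) \<le> b * ((1 + b / y) powr p - 1)"
proof -
  have ge1: "1 \<le> (1 + b / y) powr p" using p y b by (intro ge_one_powr_ge_zero) auto
  then show "0 \<le> b * ((1 + b / y) powr p - 1)" using b by simp
  have "b / y \<le> b" using y b by (simp add: divide_le_eq mult_le_cancel_left1)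
  then have "(1 + b / y) powr p \<le> (1 + b) powr p" using p y b by (intro powr_mono2) auto
  then have "b * ((1 + b / y) powr p - 1) \<le> (1 + b) * (1 + b) powr p"
    using b ge1 by (intro mult_mono) auto
  also have "\<dots> = (1 + b) powr (p + 1)" using b by (simp add: powr_add)
  finally show "b * ((1 + b / y) powr p - 1) \<le> (1 + b) powr (p + 1)" .
  have "b / y' \<le> b / y" using y b by (intro divide_left_mono) auto
  then show "b * ((1 + b / y') powr p - 1) \<le> b * ((1 + b / y) powr p - 1)"
    using p y b by (intro mult_left_mono diff_right_mono powr_mono2) auto
qed

lemma integrable_increment_excess:
  fixes \<xi> :: "'w \<Rightarrow> real"
  assumes "1 \<le> p" "\<And>\<omega>. 0 \<le> \<xi> \<omega>" "1 \<le> y"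
    and "integrable (measure_pmf M) (\<lambda>\<omega>. (1 + \<xi> \<omega>) powr (p + 1))"
  shows "integrable (measure_pmf M) (\<lambda>\<omega>. \<xi> \<omega> * ((1 + \<xi> \<omega> / y) powr p - 1))"
  using assms increment_excess_bounds(1,2)[OF assms(1,2) assms(3) order_refl]
  by (intro Bochner_Integration.integrable_bound[OF assms(4)]) (auto simp: abs_of_nonneg)

text \<open>The integrand vanishes pointwise as \<open>y\<close> grows and is dominated by the
  (p+1)-st moment, so its mean tends to 0 by dominated convergence.\<close>

lemma increment_excess_small:
  fixes \<xi> :: "'w \<Rightarrow> real"
  assumes p: "1 \<le> p" and c: "0 < c" and \<xi>: "\<And>\<omega>. 0 \<le> \<xi> \<omega>"
    and int: "integrable (measure_pmf M) (\<lambda>\<omega>. (1 + \<xi> \<omega>) powr (p + 1))"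
  shows "\<exists>R\<ge>1. \<forall>y\<ge>R. measure_pmf.expectation M (\<lambda>\<omega>. \<xi> \<omega> * ((1 + \<xi> \<omega> / y) powr p - 1)) \<le> c"
proof -
  let ?E = "\<lambda>y. measure_pmf.expectation M (\<lambda>\<omega>. \<xi> \<omega> * ((1 + \<xi> \<omega> / y) powr p - 1))"
  have "(\<lambda>n. ?E (real (Suc n))) \<longlonglongrightarrow> measure_pmf.expectation M (\<lambda>\<omega>. \<xi> \<omega> * ((1 + 0) powr p - 1))"
  proof (rule integral_dominated_convergence[OF _ _ int])
    show "AE \<omega> in M. (\<lambda>n. \<xi> \<omega> * ((1 + \<xi> \<omega> / real (Suc n)) powr p - 1)) \<longlonglongrightarrow> \<xi> \<omega> * ((1 + 0) powr p - 1)"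
    proof (intro AE_I2 tendsto_intros)
      show "(\<lambda>n. \<xi> \<omega> / real (Suc n)) \<longlonglongrightarrow> 0" for \<omega>
        using LIMSEQ_Suc[OF lim_const_over_n[of "\<xi> \<omega>"]] by simp
    qed auto
    show "AE \<omega> in M. norm (\<xi> \<omega> * ((1 + \<xi> \<omega> / real (Suc n)) powr p - 1)) \<le> (1 + \<xi> \<omega>) powr (p + 1)" for n
      using increment_excess_bounds(1,2)[OF p \<xi>, of "real (Suc n)" "real (Suc n)"] by (auto simp: abs_of_nonneg)
  qed auto
  then have "(\<lambda>n. ?E (real (Suc n))) \<longlonglongrightarrow> 0" by simp
  then have "\<forall>\<^sub>F n in sequentially. ?E (real (Suc n)) < c"
    using c by (rule order_tendstoD(2))
  then obtain n where n: "?E (real (Suc n)) < c"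
    by (auto simp: eventually_sequentially)
  \<comment> \<open>The limit was taken along integers; monotonicity extends the bound to real
    \<open>y\<close>.\<close>
  have "?E y \<le> c" if "real (Suc n) \<le> y" for y
  proof -
    have "?E y \<le> ?E (real (Suc n))"
      using that p \<xi> int
      by (intro integral_mono integrable_increment_excess increment_excess_bounds(3)) auto
    then show ?thesis using n by linarith
  qed
  then show ?thesis by (intro exI[of _ "real (Suc n)"]) auto
qed

text \<open>Transfers a drift of the increment \<open>D\<close> to the (p+1)-st power: the
  first-order term yields the drift, and the error term is small for large \<open>y\<close>.\<close>

lemma powr_drift:
  fixes D \<xi> :: "'w \<Rightarrow> real"
  assumes p: "1 \<le> p" and c: "0 \<le> c" and y: "1 \<le> y"
    and pos: "\<And>\<omega>. 0 < y + D \<omega>" and D: "\<And>\<omega>. \<bar>D \<omega>\<bar> \<le> \<xi> \<omega>" and \<xi>: "\<And>\<omega>. 0 \<le> \<xi> \<omega>"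
    and int: "integrable (measure_pmf M) (\<lambda>\<omega>. (1 + \<xi> \<omega>) powr (p + 1))"
    and int_D: "integrable (measure_pmf M) D"
    and excess: "measure_pmf.expectation M (\<lambda>\<omega>. \<xi> \<omega> * ((1 + \<xi> \<omega> / y) powr p - 1)) \<le> c"
    and drift: "measure_pmf.expectation M D \<le> - 2 * c"
  shows "integrable (measure_pmf M) (\<lambda>\<omega>. (y + D \<omega>) powr (p + 1))"
    and "measure_pmf.expectation M (\<lambda>\<omega>. (y + D \<omega>) powr (p + 1)) \<le> y powr (p + 1) - c * y powr p"
proof -
  let ?b = "\<lambda>\<omega>. y powr (p + 1) + (p + 1) * y powr p * (D \<omega> + \<xi> \<omega> * ((1 + \<xi> \<omega> / y) powr p - 1))"
  have le: "(y + D \<omega>) powr (p + 1) \<le> ?b \<omega>" for \<omega>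
    using p y pos D by (intro powr_add_one_increment) auto
  have int_e: "integrable (measure_pmf M) (\<lambda>\<omega>. \<xi> \<omega> * ((1 + \<xi> \<omega> / y) powr p - 1))"
    using p \<xi> y int by (rule integrable_increment_excess)
  have int_b: "integrable (measure_pmf M) ?b"
    using int_D int_e by (intro Bochner_Integration.integrable_add integrable_mult_right) auto
  show int': "integrable (measure_pmf M) (\<lambda>\<omega>. (y + D \<omega>) powr (p + 1))"
    using le by (intro Bochner_Integration.integrable_bound[OF int_b]) (auto intro: order_trans[OF _ abs_ge_self])
  have "measure_pmf.expectation M (\<lambda>\<omega>. (y + D \<omega>) powr (p + 1)) \<le> measure_pmf.expectation M ?b"
    using int' int_b le by (rule integral_mono)
  also have "\<dots> = y powr (p + 1) + (p + 1) * y powr p *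
      (measure_pmf.expectation M D + measure_pmf.expectation M (\<lambda>\<omega>. \<xi> \<omega> * ((1 + \<xi> \<omega> / y) powr p - 1)))"
    using int_D int_e by simp
  \<comment> \<open>Half of the drift \<open>- 2 * c\<close> pays for the excess; the factor p + 1
    on the other half is dropped afterwards.\<close>
  also have "\<dots> \<le> y powr (p + 1) + (p + 1) * y powr p * (- c)"
    using excess drift p by (intro add_left_mono mult_left_mono) auto
  also have "\<dots> \<le> y powr (p + 1) - c * y powr p"
    using p c by (simp add: algebra_simps)
  finally show "measure_pmf.expectation M (\<lambda>\<omega>. (y + D \<omega>) powr (p + 1)) \<le> y powr (p + 1) - c * y powr p" .
qed

section \<open>Removal of the exceptional set\<close>

text \<open>At a common late time every start occurring in \<open>D\<close> gives positive mass to
  \<open>z\<close>, and two independent copies are then both at \<open>z\<close> with positive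
  probability. Finiteness makes the time and the bound uniform.\<close>

lemma unmet_uniform_on_finite:
  fixes K :: "'s \<Rightarrow> 's pmf"
  assumes D: "finite D" and z: "\<And>x. \<exists>n. \<forall>m\<ge>n. 0 < pmf (iter_pmf K x m) z"
  shows "\<exists>N \<eta>. 0 < \<eta> \<and> (\<forall>(x, y)\<in>D. unmet K N x y \<le> 1 - \<eta>)"
proof -
  obtain n where n: "\<And>x m. n x \<le> m \<Longrightarrow> 0 < pmf (iter_pmf K x m) z"
    using z by metis
  \<comment> \<open>The inserted 0 here, and the inserted 1 in \<open>\<eta>\<close>, keep the
    maximum and the minimum meaningful when \<open>D\<close> is empty.\<close>
  define N where "N = Max (insert 0 (n ` (fst ` D \<union> snd ` D)))"
  define \<eta> where "\<eta> = Min (insert 1 ((\<lambda>(x, y). pmf (iter_pmf K x N) z * pmf (iter_pmf K y N) z) ` D))"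
  have N: "n x \<le> N \<and> n y \<le> N" if "(x, y) \<in> D" for x y
    using D that unfolding N_def by (auto intro!: Max_ge image_eqI[where f = n] rev_image_eqI[OF that])
  have "0 < \<eta>"
    unfolding \<eta>_def using D N n by (subst Min_gr_iff) auto
  moreover have "unmet K N x y \<le> 1 - \<eta>" if "(x, y) \<in> D" for x y
  proof -
    have "\<eta> \<le> pmf (iter_pmf K x N) z * pmf (iter_pmf K y N) z"
      unfolding \<eta>_def using D that by (intro Min_le) (auto intro: rev_image_eqI)
    then show ?thesis using unmet_le[of K N x y z] by linarith
  qed
  ultimately show ?thesis by auto
qed

text \<open>
  The potential \<open>u\<close> decreases by \<open>1 - unmet K N\<close> in every step, which turns the geometric trials
  on the exceptional set of a drift condition into a drift.
\<close>

lemma expectation_sum_unmet: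
  assumes "x \<noteq> y"
  shows "measure_pmf.expectation (pair_pmf (K x) (K y)) (\<lambda>(x', y'). \<Sum>k<N. unmet K k x' y') =
    (\<Sum>k<N. unmet K k x y) - (1 - unmet K N x y)"
proof -
  have "measure_pmf.expectation (pair_pmf (K x) (K y)) (\<lambda>z. \<Sum>k<N. (case z of (x', y') \<Rightarrow> unmet K k x' y')) =
      (\<Sum>k<N. unmet K (Suc k) x y)"
    using assms by (subst Bochner_Integration.integral_sum) (auto intro!: integrable_unmet)
  \<comment> \<open>Averaging over one step raises each index by one, so the sum gains its term at N
    and loses its term at 0, which is 1.\<close>
  also have "\<dots> = (\<Sum>k<Suc N. unmet K k x y) - unmet K 0 x y"
    by (simp only: sum.lessThan_Suc_shift)
  also have "\<dots> = (\<Sum>k<N. unmet K k x y) - (1 - unmet K N x y)"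
    using assms by simp
  finally show ?thesis by (simp add: case_prod_unfold)
qed

text \<open>One step of the pair is a function of noise in \<open>M x y\<close>, and the law
  \<open>\<nu>\<close> of \<open>\<xi>\<close> is the same for all pairs. This uniformity gives one
  threshold beyond which the error terms of \<open>powr_drift\<close> are small for every
  pair.\<close>

theorem polynomial_ergodicity_of_drift:
  fixes K :: "'s \<Rightarrow> 's pmf" and G :: "'s \<Rightarrow> 's \<Rightarrow> real"
    and M :: "'s \<Rightarrow> 's \<Rightarrow> 'w pmf" and \<Phi> :: "'s \<Rightarrow> 's \<Rightarrow> 'w \<Rightarrow> 's \<times> 's" and \<xi> :: "'w \<Rightarrow> real"
  assumes p: "1 \<le> p" and c: "0 < c" and D: "finite D" and G: "\<And>x y. 0 \<le> G x y"
    and rep: "\<And>x y. pair_pmf (K x) (K y) = map_pmf (\<Phi> x y) (M x y)"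
    and noise: "\<And>x y. map_pmf \<xi> (M x y) = \<nu>"
    and \<xi>: "\<And>\<omega>. 0 \<le> \<xi> \<omega>"
    and moment: "integrable (measure_pmf \<nu>) (\<lambda>t. (1 + \<bar>t\<bar>) powr (p + 1))"
    and increment: "\<And>x y \<omega>. \<bar>case_prod G (\<Phi> x y \<omega>) - G x y\<bar> \<le> \<xi> \<omega>"
    and drift: "\<And>x y. (x, y) \<notin> D \<Longrightarrow>
      measure_pmf.expectation (M x y) (\<lambda>\<omega>. case_prod G (\<Phi> x y \<omega>) - G x y) \<le> - c"
    and step_moment: "\<And>x. integrable (measure_pmf (K x)) (\<lambda>y. (1 + G x y) powr (p + 1))"
    and meet: "\<And>x. \<exists>n. \<forall>m\<ge>n. 0 < pmf (iter_pmf K x m) z"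
  shows "\<exists>!\<pi>. bind_pmf \<pi> K = \<pi>"
    and "bind_pmf \<pi> K = \<pi> \<Longrightarrow> (\<lambda>n. real n powr p * tv_dist (iter_pmf K x n) \<pi>) \<longlonglongrightarrow> 0"
proof -
  obtain N \<eta> where \<eta>: "0 < \<eta>" and N: "\<And>x y. (x, y) \<in> D \<Longrightarrow> unmet K N x y \<le> 1 - \<eta>"
    using unmet_uniform_on_finite[OF D meet] by blast
  define u where "u x y = (\<Sum>k<N. unmet K k x y)" for x y
  have u0: "0 \<le> u x y" for x y unfolding u_def by (intro sum_nonneg unmet_nonneg)
  have u1: "u x y \<le> real N" for x y
    unfolding u_def using sum_bounded_above[of "{..<N}" "\<lambda>k. unmet K k x y" 1] by (simp add: unmet_le_1)
  \<comment> \<open>For \<open>A\<close> at least 1, \<open>A + f\<close> is at most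
    \<open>A * (1 + f)\<close>, so enlarging the additive constant preserves integrability.\<close>
  have powr_scale: "integrable (measure_pmf P) (\<lambda>\<omega>. (A + f \<omega>) powr (p + 1))"
    if "1 \<le> A" "\<And>\<omega>. 0 \<le> f \<omega>" "integrable (measure_pmf P) (\<lambda>\<omega>. (1 + f \<omega>) powr (p + 1))"
    for P :: "'x pmf" and f A
  proof (rule Bochner_Integration.integrable_bound)
    show "integrable (measure_pmf P) (\<lambda>\<omega>. A powr (p + 1) * (1 + f \<omega>) powr (p + 1))"
      using that by (intro integrable_mult_right) auto
    have "A + f \<omega> \<le> A * (1 + f \<omega>)" for \<omega>
      using that(1) that(2)[of \<omega>] by (simp add: distrib_left mult_le_cancel_right1)
    then have "(A + f \<omega>) powr (p + 1) \<le> (A * (1 + f \<omega>)) powr (p + 1)" for \<omega>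
      using that(1) that(2)[of \<omega>] p by (intro powr_mono2) auto
    then show "AE \<omega> in P. norm ((A + f \<omega>) powr (p + 1)) \<le> norm (A powr (p + 1) * (1 + f \<omega>) powr (p + 1))"
      using that by (auto simp: powr_mult)
  qed auto
  have "integrable (measure_pmf \<nu>) (\<lambda>t. \<bar>t\<bar>)"
  proof (rule Bochner_Integration.integrable_bound[OF moment])
    have "\<bar>t\<bar> \<le> (1 + \<bar>t\<bar>) powr (p + 1)" for t
      using powr_mono[of 1 "p + 1" "1 + \<bar>t\<bar>"] p by simp
    then show "AE t in \<nu>. norm \<bar>t\<bar> \<le> norm ((1 + \<bar>t\<bar>) powr (p + 1))" by auto
  qed auto
  then have "integrable (measure_pmf (map_pmf \<xi> (M x y))) (\<lambda>t. \<bar>t\<bar>)" for x y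
    by (simp only: noise)
  then have int_\<xi>: "integrable (measure_pmf (M x y)) \<xi>" for x y
    by (simp add: \<xi>)
  define b where "b = measure_pmf.expectation \<nu> (\<lambda>t. t)"
  have b: "measure_pmf.expectation (M x y) \<xi> = b" for x y
    unfolding b_def noise[of x y, symmetric] by simp
  have b0: "0 \<le> b"
    unfolding b[of undefined undefined, symmetric] by (simp add: \<xi> integral_nonneg_AE)
  \<comment> \<open>On \<open>D\<close> the function \<open>G\<close> may rise by \<open>b\<close>
    on average while \<open>u\<close> falls by at least \<eta>; with this weight the sum
    \<open>G + B * u\<close> still has drift at most \<open>- c\<close>.\<close>
  define B where "B = (b + c) / \<eta>"
  have B0: "0 \<le> B" using b0 c \<eta> by (simp add: B_def)
  \<comment> \<open>Half of the drift is spent on the growing clock; the drift that remains is at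
    most \<open>- c / 2\<close>.\<close>
  define \<epsilon> where "\<epsilon> = c / 2"
  have \<epsilon>: "0 < \<epsilon>" using c by (simp add: \<epsilon>_def)
  \<comment> \<open>Bounds the change of \<open>B * u\<close> plus the clock increment, since
    \<open>u\<close> ranges between 0 and \<open>N\<close>.\<close>
  define a where "a = B * real N + \<epsilon>"
  have a0: "0 \<le> a" using B0 \<epsilon> by (simp add: a_def)
  have int_a: "integrable (measure_pmf \<nu>) (\<lambda>t. (1 + (\<bar>t\<bar> + a)) powr (p + 1))"
    using powr_scale[of "1 + a" "\<lambda>t. \<bar>t\<bar>" \<nu>] moment a0 by (simp add: ac_simps)
  \<comment> \<open>The drift \<open>- c / 2\<close> equals \<open>- 2 * (c / 4)\<close>, so
    \<open>powr_drift\<close> applies once the excess is at most \<open>c / 4\<close>.\<close>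
  have "0 < c / 4" using c by simp
  from increment_excess_small[OF p this _ int_a] a0
  obtain R where R: "1 \<le> R" and excess: "\<And>y. R \<le> y \<Longrightarrow>
      measure_pmf.expectation \<nu> (\<lambda>t. (\<bar>t\<bar> + a) * ((1 + (\<bar>t\<bar> + a) / y) powr p - 1)) \<le> c / 4"
    by auto
  \<comment> \<open>Adding \<open>R\<close> keeps every value above the threshold, so that the
    excess bound holds at all pairs.\<close>
  define H where "H x y = R + G x y + B * u x y" for x y
  have H: "R \<le> H x y" for x y
    using G[of x y] B0 u0[of x y] by (simp add: H_def)
  have H_drift: "integrable (pair_pmf (K x) (K y)) (\<lambda>(x', y'). (H x' y' + m + \<epsilon>) powr (p + 1)) \<and>
      measure_pmf.expectation (pair_pmf (K x) (K y)) (\<lambda>(x', y'). (H x' y' + m + \<epsilon>) powr (p + 1))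
        \<le> (H x y + m) powr (p + 1) - c / 4 * (H x y + m) powr p"
    if xy: "x \<noteq> y" and m: "0 \<le> m" for x y m
  proof -
    \<comment> \<open>The full increment, from \<open>H x y + m\<close> to the new value of
      \<open>H\<close> plus \<open>m + \<epsilon>\<close>.\<close>
    define d where "d \<omega> = (case_prod G (\<Phi> x y \<omega>) - G x y) + (B * (case_prod u (\<Phi> x y \<omega>) - u x y) + \<epsilon>)" for \<omega>
    have eq: "(case \<Phi> x y \<omega> of (x', y') \<Rightarrow> (H x' y' + m + \<epsilon>) powr (p + 1)) = (H x y + m + d \<omega>) powr (p + 1)" for \<omega>
      by (simp add: d_def H_def case_prod_unfold algebra_simps)
    have int_u: "integrable (measure_pmf (M x y)) (\<lambda>\<omega>. case_prod u (\<Phi> x y \<omega>))"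
      using u0 u1 by (intro integrable_pmf_bounded[where B = "real N"]) (auto simp: case_prod_unfold abs_of_nonneg)
    have int_G: "integrable (measure_pmf (M x y)) (\<lambda>\<omega>. case_prod G (\<Phi> x y \<omega>) - G x y)"
      by (rule Bochner_Integration.integrable_bound[OF int_\<xi>[of x y]])
        (auto intro!: AE_I2 order_trans[OF increment abs_ge_self])
    have E_u: "measure_pmf.expectation (M x y) (\<lambda>\<omega>. case_prod u (\<Phi> x y \<omega>)) = u x y - (1 - unmet K N x y)"
    proof -
      have "measure_pmf.expectation (M x y) (\<lambda>\<omega>. case_prod u (\<Phi> x y \<omega>)) =
          measure_pmf.expectation (pair_pmf (K x) (K y)) (\<lambda>(x', y'). u x' y')"
        unfolding rep by simp
      then show ?thesis unfolding u_def using expectation_sum_unmet[OF xy] by simp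
    qed
    have "\<bar>d \<omega>\<bar> \<le> \<bar>\<xi> \<omega>\<bar> + a" for \<omega>
    proof -
      have "\<bar>case_prod u (\<Phi> x y \<omega>) - u x y\<bar> \<le> real N"
        using u0[of x y] u1[of x y] u0[of "fst (\<Phi> x y \<omega>)" "snd (\<Phi> x y \<omega>)"] u1[of "fst (\<Phi> x y \<omega>)" "snd (\<Phi> x y \<omega>)"]
        by (simp add: case_prod_unfold abs_le_iff)
      then have "\<bar>B * (case_prod u (\<Phi> x y \<omega>) - u x y)\<bar> \<le> B * real N"
        using B0 by (simp add: abs_mult mult_left_mono)
      then show ?thesis using increment[of x y \<omega>] \<epsilon> \<xi>[of \<omega>] unfolding d_def a_def by linarith
    qed
    moreover have "0 < H x y + m + d \<omega>" for \<omega>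
    proof -
      have "H x y + m + d \<omega> = case_prod H (\<Phi> x y \<omega>) + m + \<epsilon>"
        by (simp add: d_def H_def case_prod_unfold algebra_simps)
      then show ?thesis using H[of "fst (\<Phi> x y \<omega>)" "snd (\<Phi> x y \<omega>)"] R m \<epsilon> by (simp add: case_prod_unfold)
    qed
    moreover have "integrable (measure_pmf (M x y)) (\<lambda>\<omega>. (1 + (\<bar>\<xi> \<omega>\<bar> + a)) powr (p + 1))"
      using int_a unfolding noise[of x y, symmetric] by simp
    moreover have "integrable (measure_pmf (M x y)) d"
      unfolding d_def using int_u int_G by auto
    moreover have "measure_pmf.expectation (M x y) (\<lambda>\<omega>. (\<bar>\<xi> \<omega>\<bar> + a) * ((1 + (\<bar>\<xi> \<omega>\<bar> + a) / (H x y + m)) powr p - 1)) \<le> c / 4"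
      using excess[of "H x y + m"] H[of x y] m unfolding noise[of x y, symmetric] by simp
    moreover have "measure_pmf.expectation (M x y) d \<le> - 2 * (c / 4)"
    proof -
      have E_d: "measure_pmf.expectation (M x y) d =
          measure_pmf.expectation (M x y) (\<lambda>\<omega>. case_prod G (\<Phi> x y \<omega>) - G x y) - B * (1 - unmet K N x y) + \<epsilon>"
      proof -
        have "measure_pmf.expectation (M x y) d =
            measure_pmf.expectation (M x y) (\<lambda>\<omega>. case_prod G (\<Phi> x y \<omega>) - G x y) +
            (B * (measure_pmf.expectation (M x y) (\<lambda>\<omega>. case_prod u (\<Phi> x y \<omega>)) - u x y) + \<epsilon>)"
          unfolding d_def
          by (subst Bochner_Integration.integral_add[OF int_G]) (use int_u in simp_all)
        then show ?thesis unfolding E_u by (simp add: right_diff_distrib)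
      qed
      show ?thesis
      proof (cases "(x, y) \<in> D")
        case True
        have "measure_pmf.expectation (M x y) (\<lambda>\<omega>. case_prod G (\<Phi> x y \<omega>) - G x y) \<le> b"
          unfolding b[of x y, symmetric] using int_G int_\<xi> increment
          by (intro integral_mono) (auto intro: order_trans[OF abs_ge_self])
        moreover have "B * \<eta> \<le> B * (1 - unmet K N x y)"
          using N[OF True] B0 by (intro mult_left_mono) auto
        moreover have "B * \<eta> = b + c" using \<eta> by (simp add: B_def)
        ultimately show ?thesis unfolding E_d \<epsilon>_def by linarith
      next
        case False
        have "0 \<le> B * (1 - unmet K N x y)" using B0 by (simp add: unmet_le_1)
        then show ?thesis using drift[OF False] unfolding E_d \<epsilon>_def by linarith
      qed
    qed
    ultimately have "integrable (measure_pmf (M x y)) (\<lambda>\<omega>. (H x y + m + d \<omega>) powr (p + 1)) \<and>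
      measure_pmf.expectation (M x y) (\<lambda>\<omega>. (H x y + m + d \<omega>) powr (p + 1))
        \<le> (H x y + m) powr (p + 1) - c / 4 * (H x y + m) powr p"
      using powr_drift[of p "c / 4" "H x y + m" d "\<lambda>\<omega>. \<bar>\<xi> \<omega>\<bar> + a" "M x y"] p c R H[of x y] m a0 by simp
    then show ?thesis
      unfolding rep by (simp add: eq)
  qed
  \<comment> \<open>Undoes the gain \<open>c / 4\<close> and the factor
    \<open>\<epsilon> powr p\<close> contained in the clock weight.\<close>
  define C where "C = 4 / (c * \<epsilon> powr p)"
  have C0: "0 \<le> C" using c by (simp add: C_def)
  have sum_le: "(\<Sum>n<L. real n powr p * unmet K n x y) \<le> C * H x y powr (p + 1)" for x y L
  proof -
    have "c / 4 * (\<Sum>n<L. (\<epsilon> * real n + 0) powr p * unmet K n x y) \<le> (H x y + 0) powr (p + 1)"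
    proof (rule unmet_weighted_sum)
      show "0 \<le> H x y" for x y using H[of x y] R by linarith
    qed (use p c \<epsilon> H_drift in auto)
    then have "c / 4 * (\<epsilon> powr p * (\<Sum>n<L. real n powr p * unmet K n x y)) \<le> H x y powr (p + 1)"
      using \<epsilon> by (simp add: powr_mult sum_distrib_left mult.assoc)
    then show ?thesis
      using c \<epsilon> unfolding C_def by (simp add: field_simps)
  qed
  \<comment> \<open>The second copy starts from one step of the first, so the bound on the weighted
    sum has to be integrated over \<open>K x\<close>; \<open>u\<close> is bounded and
    \<open>G\<close> is covered by \<open>step_moment\<close>.\<close>
  have int_H: "integrable (measure_pmf (K x)) (\<lambda>y. H x y powr (p + 1))" for x
  proof (rule Bochner_Integration.integrable_bound)
    have "1 \<le> R + B * real N" using R B0 by (simp add: add_increasing2)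
    then show "integrable (measure_pmf (K x)) (\<lambda>y. (R + B * real N + G x y) powr (p + 1))"
      using G step_moment by (rule powr_scale)
    have "B * u x y \<le> B * real N" for y
      using B0 u1 by (intro mult_left_mono) auto
    then have "H x y powr (p + 1) \<le> (R + B * real N + G x y) powr (p + 1)" for y
      using p R H[of x y] by (intro powr_mono2) (auto simp: H_def)
    then show "AE y in K x. norm (H x y powr (p + 1)) \<le> norm ((R + B * real N + G x y) powr (p + 1))"
      by auto
  qed auto
  have bounded: "\<exists>C'. \<forall>L. (\<Sum>n<L. real n powr p * measure_pmf.expectation (K x) (unmet K n x)) \<le> C'" for x
  proof (intro exI allI)
    fix L
    have "(\<Sum>n<L. real n powr p * measure_pmf.expectation (K x) (unmet K n x)) =
        measure_pmf.expectation (K x) (\<lambda>y. \<Sum>n<L. real n powr p * unmet K n x y)"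
      by (subst Bochner_Integration.integral_sum) (auto intro!: integrable_mult_right integrable_unmet')
    also have "\<dots> \<le> measure_pmf.expectation (K x) (\<lambda>y. C * H x y powr (p + 1))"
      using int_H sum_le
      by (intro integral_mono Bochner_Integration.integrable_sum integrable_mult_right integrable_unmet')
    finally show "(\<Sum>n<L. real n powr p * measure_pmf.expectation (K x) (unmet K n x))
      \<le> measure_pmf.expectation (K x) (\<lambda>y. C * H x y powr (p + 1))" .
  qed
  have lim: "(\<lambda>n. unmet K n x y) \<longlonglongrightarrow> 0" for x y
  proof (rule Lim_null_comparison)
    have "summable (\<lambda>n. real n powr p * unmet K n x y)"
      using sum_le by (intro summableI_nonneg_bounded) (auto simp: unmet_nonneg)
    then show "(\<lambda>n. real n powr p * unmet K n x y) \<longlonglongrightarrow> 0"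
      by (rule summable_LIMSEQ_zero)
    have "unmet K n x y \<le> real n powr p * unmet K n x y" if "1 \<le> n" for n
    proof -
      have "1 \<le> real n powr p" using that p by (intro ge_one_powr_ge_zero) auto
      then show ?thesis using mult_right_mono[of 1 "real n powr p" "unmet K n x y"] by (simp add: unmet_nonneg)
    qed
    then show "\<forall>\<^sub>F n in sequentially. norm (unmet K n x y) \<le> real n powr p * unmet K n x y"
      by (auto simp: eventually_sequentially unmet_nonneg intro!: exI[of _ 1])
  qed
  have p0: "0 \<le> p" using p by simp
  show "\<exists>!\<pi>. bind_pmf \<pi> K = \<pi>"
    by (rule polynomial_ergodicity_of_unmet(1)[OF p0 bounded lim])
  show "(\<lambda>n. real n powr p * tv_dist (iter_pmf K x n) \<pi>) \<longlonglongrightarrow> 0" if "bind_pmf \<pi> K = \<pi>"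
    by (rule polynomial_ergodicity_of_unmet(2)[OF p0 bounded lim that])
qed

section \<open>The access network\<close>

lemma self_in_nbhd [simp]: "i \<in> nbhd E i"
  by (simp add: nbhd_def)

lemma nbhd_sym: "sym E \<Longrightarrow> j \<in> nbhd E i \<longleftrightarrow> i \<in> nbhd E j"
  by (auto simp: nbhd_def sym_def)

lemma binomial_parameter: "1 / real (n :: nat) \<in> {0..1}"
  by (cases n) auto

lemma expectation_departure:
  fixes E :: "('v::finite \<times> 'v) set"
  defines "q \<equiv> \<lambda>w j. 1 / real (\<Sum>k\<in>nbhd E j. w k)"
  shows "measure_pmf.expectation (attempts E w) (\<lambda>N. real (departure E N i)) =
    real (w i) * q w i * (1 - q w i) ^ (w i - 1) * (\<Prod>j\<in>nbhd E i - {i}. (1 - q w j) ^ w j)"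
proof -
  have q: "q w j \<in> {0..1}" for j
    unfolding q_def by (rule binomial_parameter)
  \<comment> \<open>The departure indicator as a product over all vertices, with factor 1 outside
    the neighbourhood, so that independence turns its mean into a product of binomial
    probabilities.\<close>
  define f :: "'v \<Rightarrow> nat \<Rightarrow> real" where
    "f j n = (if j = i then indicator {1} n else if j \<in> nbhd E i then indicator {0} n else 1)" for j n
  have "real (departure E N i) = (\<Prod>j\<in>UNIV. f j (N j))" for N
  proof -
    have "(\<Prod>j\<in>UNIV. f j (N j)) = f i (N i) * (\<Prod>j\<in>UNIV - {i}. f j (N j))"
      by (rule prod.remove) auto
    also have "(\<Prod>j\<in>UNIV - {i}. f j (N j)) = (\<Prod>j\<in>nbhd E i - {i}. f j (N j))"
      by (rule prod.mono_neutral_right) (auto simp: f_def)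
    also have "\<dots> = (\<Prod>j\<in>nbhd E i - {i}. of_bool (N j = 0))"
      by (rule prod.cong) (auto simp: f_def)
    finally show ?thesis by (simp add: departure_def f_def of_nat_prod)
  qed
  then have "measure_pmf.expectation (attempts E w) (\<lambda>N. real (departure E N i)) =
      measure_pmf.expectation (Pi_pmf UNIV 0 (\<lambda>j. binomial_pmf (w j) (q w j))) (\<lambda>N. \<Prod>j\<in>UNIV. f j (N j))"
    by (simp add: attempts_def q_def)
  also have "\<dots> = (\<Prod>j\<in>UNIV. measure_pmf.expectation (binomial_pmf (w j) (q w j)) (f j))"
    by (rule expectation_prod_Pi_pmf)
       (auto simp: f_def indicator_def intro!: integrable_pmf_bounded[where B = 1])
  also have "\<dots> = measure_pmf.expectation (binomial_pmf (w i) (q w i)) (f i) *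
      (\<Prod>j\<in>UNIV - {i}. measure_pmf.expectation (binomial_pmf (w j) (q w j)) (f j))"
    by (rule prod.remove) auto
  also have "(\<Prod>j\<in>UNIV - {i}. measure_pmf.expectation (binomial_pmf (w j) (q w j)) (f j)) =
      (\<Prod>j\<in>nbhd E i - {i}. measure_pmf.expectation (binomial_pmf (w j) (q w j)) (f j))"
  proof (rule prod.mono_neutral_right)
    show "\<forall>j\<in>UNIV - {i} - (nbhd E i - {i}). measure_pmf.expectation (binomial_pmf (w j) (q w j)) (f j) = 1"
    proof
      fix j assume "j \<in> UNIV - {i} - (nbhd E i - {i})"
      then have "f j = (\<lambda>_. 1)" by (auto simp: f_def)
      then show "measure_pmf.expectation (binomial_pmf (w j) (q w j)) (f j) = 1" by simp
    qed
  qed auto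
  also have "\<dots> = (\<Prod>j\<in>nbhd E i - {i}. (1 - q w j) ^ w j)"
    using q by (intro prod.cong) (auto simp: f_def[abs_def] measure_pmf_single)
  also have "measure_pmf.expectation (binomial_pmf (w i) (q w i)) (f i) = real (w i) * q w i * (1 - q w i) ^ (w i - 1)"
    using q[of i] by (simp add: f_def[abs_def] measure_pmf_single)
  finally show ?thesis .
qed

text \<open>The inequality 1 + x \<le> exp x at x = 1/(s-1) gives 1 - 1/s \<ge> exp(-1/(s-1)).
  Replacing w/(s-1) by w/s costs at most 1/(s-1), hence at most 1/n.\<close>

lemma one_minus_inverse_power_ge:
  fixes s w n :: nat
  assumes n: "1 \<le> n" "n < s" and w: "w \<le> s"
  shows "exp (- (real w / real s) - 1 / real n) \<le> (1 - 1 / real s) ^ w"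
proof -
  have s: "1 < real s" using n by simp
  have "1 + 1 / (real s - 1) \<le> exp (1 / (real s - 1))" by (rule exp_ge_add_one_self)
  then have "exp (- (1 / (real s - 1))) \<le> 1 / (1 + 1 / (real s - 1))"
    using s by (simp add: exp_minus divide_inverse add_pos_pos)
  also have "\<dots> = 1 - 1 / real s" using s by (simp add: field_simps)
  finally have "exp (- (1 / (real s - 1))) ^ w \<le> (1 - 1 / real s) ^ w"
    by (intro power_mono) auto
  moreover have "exp (- (1 / (real s - 1))) ^ w = exp (- (real w / (real s - 1)))"
    by (simp flip: exp_of_nat_mult)
  moreover have "real w / (real s - 1) \<le> real w / real s + 1 / real n"
  proof -
    have "real w / (real s - 1) - real w / real s = (real w / real s) * (1 / (real s - 1))"
      using s by (simp add: field_simps)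
    also have "\<dots> \<le> 1 * (1 / real n)"
      using s n w by (intro mult_mono divide_left_mono) auto
    finally show ?thesis by simp
  qed
  ultimately show ?thesis by (smt (verit) exp_le_cancel_iff)
qed

text \<open>The neighbourhood sum at \<open>i\<close> cancels the success parameter at
  \<open>i\<close>, leaving \<open>w i\<close> times powers of 1 - 1/s. If \<open>w i\<close>
  exceeds \<open>n\<close>, each power is estimated at the cost of a factor exp(-1/n), one per
  neighbour; otherwise the main term is at most \<open>n\<close>, which the subtracted constant
  absorbs.\<close>

lemma expectation_departure_lower_bound:
  fixes E :: "('v::finite \<times> 'v) set"
  assumes E: "sym E" and n: "1 \<le> n"
  shows "exp (- (real (card (nbhd E i)) / real n)) * (real (w i) * exp (- (\<Sum>j\<in>nbhd E i. real (w j) / real (\<Sum>k\<in>nbhd E j. w k))))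
      - real n
    \<le> real (\<Sum>k\<in>nbhd E i. w k) * measure_pmf.expectation (attempts E w) (\<lambda>N. real (departure E N i))"
    (is "?c * (_ * exp (- ?y)) - _ \<le> ?S * ?d")
proof (cases "n < w i")
  case False
  have "?y \<ge> 0" by (intro sum_nonneg divide_nonneg_nonneg of_nat_0_le_iff)
  then have "?c * (real (w i) * exp (- ?y)) \<le> 1 * (real n * 1)"
    using False by (intro mult_mono) auto
  moreover have "0 \<le> ?S * ?d" by (intro mult_nonneg_nonneg integral_nonneg_AE of_nat_0_le_iff) auto
  ultimately show ?thesis by linarith
next
  case True
  define s where "s j = (\<Sum>k\<in>nbhd E j. w k)" for j
  have w_le: "w k \<le> s j" if "k \<in> nbhd E j" for j k
    using that unfolding s_def by (intro member_le_sum) auto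
  \<comment> \<open>By symmetry \<open>i\<close> is a neighbour of \<open>j\<close>, so
    \<open>s j\<close> counts \<open>w i\<close>.\<close>
  have n_less: "n < s j" if "j \<in> nbhd E i" for j
    using w_le[of i j] that True nbhd_sym[OF E, of j i] by auto
  have le_1: "1 / real (s j) \<le> 1" for j
    using binomial_parameter[of "s j"] by simp
  have "?c * exp (- ?y) = exp (\<Sum>j\<in>nbhd E i. - (real (w j) / real (s j)) - 1 / real n)"
    by (simp add: s_def sum_subtractf sum_negf exp_diff exp_minus divide_inverse)
  also have "\<dots> = (\<Prod>j\<in>nbhd E i. exp (- (real (w j) / real (s j)) - 1 / real n))"
    by (rule exp_sum) auto
  also have "\<dots> \<le> (\<Prod>j\<in>nbhd E i. (1 - 1 / real (s j)) ^ w j)"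
    using n n_less w_le by (intro prod_mono conjI one_minus_inverse_power_ge) auto
  also have "\<dots> = (1 - 1 / real (s i)) ^ w i * (\<Prod>j\<in>nbhd E i - {i}. (1 - 1 / real (s j)) ^ w j)"
    by (rule prod.remove) auto
  also have "\<dots> \<le> (1 - 1 / real (s i)) ^ (w i - 1) * (\<Prod>j\<in>nbhd E i - {i}. (1 - 1 / real (s j)) ^ w j)"
    using le_1 by (intro mult_right_mono power_decreasing prod_nonneg zero_le_power) auto
  finally have "real (w i) * (?c * exp (- ?y)) \<le>
      real (w i) * ((1 - 1 / real (s i)) ^ (w i - 1) * (\<Prod>j\<in>nbhd E i - {i}. (1 - 1 / real (s j)) ^ w j))"
    by (intro mult_left_mono) auto
  also have "\<dots> = ?S * ?d"
    using n_less[of i] unfolding expectation_departure s_def[symmetric] by (simp add: field_simps)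
  finally show ?thesis by (simp add: mult.left_commute)
qed

text \<open>
  Convexity of the exponential function at \<open>-1\<close> replaces Jensen's inequality: the weighted sum of
  the \<open>w j / S j\<close> telescopes to the total number of users.
\<close>

lemma sum_exp_lower_bound:
  fixes E :: "('v::finite \<times> 'v) set" and w :: "'v \<Rightarrow> nat"
  assumes E: "sym E"
  shows "exp (- 1) * (\<Sum>i\<in>UNIV. real (w i)) \<le>
    (\<Sum>i\<in>UNIV. real (w i) * exp (- (\<Sum>j\<in>nbhd E i. real (w j) / real (\<Sum>k\<in>nbhd E j. w k))))"
proof -
  define s where "s j = (\<Sum>k\<in>nbhd E j. w k)" for j
  define y where "y i = (\<Sum>j\<in>nbhd E i. real (w j) / real (s j))" for i
  \<comment> \<open>Double counting: after the sums are exchanged, symmetry collects the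
    \<open>w i\<close> around each \<open>j\<close> into \<open>s j\<close>, which cancels the
    denominator.\<close>
  have "(\<Sum>i\<in>UNIV. real (w i) * y i) = (\<Sum>i\<in>UNIV. \<Sum>j\<in>UNIV. if j \<in> nbhd E i then real (w i) * (real (w j) / real (s j)) else 0)"
    by (simp add: y_def sum_distrib_left flip: sum.inter_restrict)
  also have "\<dots> = (\<Sum>j\<in>UNIV. \<Sum>i\<in>UNIV. if i \<in> nbhd E j then real (w i) * (real (w j) / real (s j)) else 0)"
    by (subst sum.swap) (simp add: nbhd_sym[OF E])
  also have "\<dots> = (\<Sum>j\<in>UNIV. real (s j) * (real (w j) / real (s j)))"
    by (simp add: s_def sum_distrib_right sum_divide_distrib flip: sum.inter_restrict)
  also have "\<dots> = (\<Sum>j\<in>UNIV. real (w j))"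
  proof (rule sum.cong)
    fix j
    \<comment> \<open>When \<open>s j\<close> is 0 the quotient is 0 by convention, and so is
      \<open>w j\<close>.\<close>
    have "w j \<le> s j" unfolding s_def by (intro member_le_sum) auto
    then show "real (s j) * (real (w j) / real (s j)) = real (w j)" by (cases "s j = 0") auto
  qed simp
  finally have sum_y: "(\<Sum>i\<in>UNIV. real (w i) * y i) = (\<Sum>i\<in>UNIV. real (w i))" .
  have tangent: "exp (- 1) * (2 - y i) \<le> exp (- y i)" for i
  proof -
    have "exp (- 1) * (1 + (1 - y i)) \<le> exp (- 1) * exp (1 - y i)"
      by (intro mult_left_mono exp_ge_add_one_self) auto
    also have "\<dots> = exp (- y i)" by (simp flip: exp_add)
    finally show ?thesis by simp
  qed
  have "exp (- 1) * (\<Sum>i\<in>UNIV. real (w i)) = exp (- 1) * (2 * (\<Sum>i\<in>UNIV. real (w i)) - (\<Sum>i\<in>UNIV. real (w i) * y i))"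
    by (simp add: sum_y)
  also have "\<dots> = (\<Sum>i\<in>UNIV. real (w i) * (exp (- 1) * (2 - y i)))"
    by (simp add: sum_distrib_left sum_subtractf algebra_simps)
  also have "\<dots> \<le> (\<Sum>i\<in>UNIV. real (w i) * exp (- y i))"
    by (intro sum_mono mult_left_mono tangent) auto
  finally show ?thesis by (simp add: y_def s_def)
qed

section \<open>One step of the chain\<close>

definition total_users :: "('v::finite \<Rightarrow> nat) \<Rightarrow> real" where
  "total_users w = (\<Sum>i\<in>UNIV. real (w i))"

lemma total_users_nonneg: "0 \<le> total_users w"
  by (simp add: total_users_def sum_nonneg)

lemma component_le_total: "real (w i) \<le> total_users w"
  unfolding total_users_def by (rule member_le_sum) auto

text \<open>The transition as a deterministic function of attempts and arrivals, the noise
  representation required by the ergodicity criterion.\<close>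

definition update :: "('v::finite \<times> 'v) set \<Rightarrow> 'v state \<Rightarrow> 'v state \<times> 'v state \<Rightarrow> 'v state" where
  "update E w = (\<lambda>(N, a) i. w i + a i - departure E N i)"

lemma step_eq_map: "step E \<mu> w = map_pmf (update E w) (pair_pmf (attempts E w) \<mu>)"
  by (simp add: step_def pair_pmf_def map_pmf_def bind_assoc_pmf bind_return_pmf update_def)

lemma law_eq_iter: "law E \<mu> x n = iter_pmf (step E \<mu>) x n"
  by (induction n) auto

lemma departure_le_1: "departure E N i \<le> 1"
proof -
  have "(\<Prod>j\<in>nbhd E i - {i}. of_bool (N j = 0) :: nat) \<le> 1"
    by (rule prod_le_1) auto
  then show ?thesis by (auto simp: departure_def)
qed

text \<open>Stated for every noise value, impossible attempts included, because the ergodicity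
  criterion asks for an increment bound that holds everywhere.\<close>

lemma update_diff_le: "\<bar>real (update E w \<omega> i) - real (w i)\<bar> \<le> real (snd \<omega> i) + 1"
  using departure_le_1[of E "fst \<omega>" i] by (auto simp: update_def case_prod_unfold)

lemma total_update_diff_le:
  fixes w :: "'v::finite state"
  shows "(\<Sum>i\<in>UNIV. \<bar>real (update E w \<omega> i) - real (w i)\<bar>) \<le> total_users (snd \<omega>) + real CARD('v)"
proof -
  have "(\<Sum>i\<in>UNIV. \<bar>real (update E w \<omega> i) - real (w i)\<bar>) \<le> (\<Sum>i\<in>UNIV. real (snd \<omega> i) + 1)"
    by (intro sum_mono update_diff_le)
  then show ?thesis by (simp add: total_users_def sum.distrib)
qed

lemma attempts_le:
  assumes "N \<in> set_pmf (attempts E w)"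
  shows "N i \<le> w i"
proof -
  define q where "q = 1 / real (\<Sum>j\<in>nbhd E i. w j)"
  have q: "0 \<le> q" "q \<le> 1"
    using binomial_parameter[of "\<Sum>j\<in>nbhd E i. w j"] unfolding q_def atLeastAtMost_iff by blast+
  have "N i \<in> set_pmf (binomial_pmf (w i) q)"
    using assms by (auto simp: attempts_def set_Pi_pmf PiE_dflt_def q_def)
  then show ?thesis
    using q by (auto simp: set_pmf_binomial_eq split: if_splits)
qed

lemma real_update:
  assumes "N \<in> set_pmf (attempts E w)"
  shows "real (update E w (N, a) i) = real (w i) + real (a i) - real (departure E N i)"
proof -
  have "departure E N i \<le> w i"
    using attempts_le[OF assms, of i] departure_le_1[of E N i]
    by (cases "N i = 1") (auto simp: departure_def)
  then show ?thesis by (simp add: update_def)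
qed

section \<open>The quadratic form and its drift\<close>

text \<open>The bilinear form of the 0/1 matrix of closed neighbourhoods, symmetric when the graph
  is.\<close>

definition pairing :: "('v::finite \<times> 'v) set \<Rightarrow> ('v \<Rightarrow> real) \<Rightarrow> ('v \<Rightarrow> real) \<Rightarrow> real" where
  "pairing E u v = (\<Sum>i\<in>UNIV. u i * (\<Sum>j\<in>nbhd E i. v j))"

lemma pairing_add_left: "pairing E (\<lambda>i. u i + u' i) v = pairing E u v + pairing E u' v"
  by (simp add: pairing_def distrib_right sum.distrib)

lemma pairing_commute:
  assumes "sym E"
  shows "pairing E u v = pairing E v u"
proof -
  have "pairing E u v = (\<Sum>i\<in>UNIV. \<Sum>j\<in>UNIV. if j \<in> nbhd E i then u i * v j else 0)"
    by (simp add: pairing_def sum_distrib_left flip: sum.inter_restrict)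
  also have "\<dots> = (\<Sum>j\<in>UNIV. \<Sum>i\<in>UNIV. if i \<in> nbhd E j then u i * v j else 0)"
    by (subst sum.swap) (simp add: nbhd_sym[OF assms])
  also have "\<dots> = pairing E v u"
    by (simp add: pairing_def sum_distrib_left mult.commute flip: sum.inter_restrict)
  finally show ?thesis .
qed

lemma pairing_abs_le: "\<bar>pairing E u v\<bar> \<le> (\<Sum>i\<in>UNIV. \<bar>u i\<bar>) * (\<Sum>i\<in>UNIV. \<bar>v i\<bar>)"
proof -
  have "\<bar>pairing E u v\<bar> \<le> (\<Sum>i\<in>UNIV. \<bar>u i * (\<Sum>j\<in>nbhd E i. v j)\<bar>)"
    unfolding pairing_def by (rule sum_abs)
  also have "\<dots> \<le> (\<Sum>i\<in>UNIV. \<bar>u i\<bar> * (\<Sum>i\<in>UNIV. \<bar>v i\<bar>))"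
  proof (rule sum_mono)
    fix i
    have "\<bar>\<Sum>j\<in>nbhd E i. v j\<bar> \<le> (\<Sum>j\<in>nbhd E i. \<bar>v j\<bar>)" by (rule sum_abs)
    also have "\<dots> \<le> (\<Sum>j\<in>UNIV. \<bar>v j\<bar>)" by (rule sum_mono2) auto
    finally show "\<bar>u i * (\<Sum>j\<in>nbhd E i. v j)\<bar> \<le> \<bar>u i\<bar> * (\<Sum>i\<in>UNIV. \<bar>v i\<bar>)"
      by (simp add: abs_mult mult_left_mono)
  qed
  finally show ?thesis by (simp add: sum_distrib_right)
qed

definition energy :: "('v::finite \<times> 'v) set \<Rightarrow> 'v state \<Rightarrow> real" where
  "energy E w = pairing E (\<lambda>i. real (w i)) (\<lambda>i. real (w i))"

lemma energy_nonneg: "0 \<le> energy E w"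
  by (simp add: energy_def pairing_def sum_nonneg)

lemma energy_le: "energy E w \<le> (total_users w)\<^sup>2"
  using pairing_abs_le[of E "\<lambda>i. real (w i)" "\<lambda>i. real (w i)"]
  by (simp add: energy_def total_users_def power2_eq_square)

text \<open>Each vertex lies in its own neighbourhood, so the energy contains the square of every
  component.\<close>

lemma component_le_sqrt_energy: "real (w i) \<le> sqrt (energy E w)"
proof (rule real_le_rsqrt)
  have "(real (w i))\<^sup>2 \<le> real (w i) * (\<Sum>j\<in>nbhd E i. real (w j))"
    unfolding power2_eq_square by (intro mult_left_mono member_le_sum) auto
  also have "\<dots> \<le> energy E w"
    unfolding energy_def pairing_def by (rule member_le_sum) (auto intro!: mult_nonneg_nonneg sum_nonneg)
  finally show "(real (w i))\<^sup>2 \<le> energy E w" .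
qed

text \<open>The factorisation of a difference of squares, valid for a symmetric bilinear
  form.\<close>

lemma energy_diff:
  assumes "sym E"
  shows "energy E w' - energy E w = pairing E (\<lambda>i. real (w' i) - real (w i)) (\<lambda>i. real (w' i) + real (w i))"
proof -
  have l: "pairing E (\<lambda>i. real (w' i) - real (w i)) v = pairing E (\<lambda>i. real (w' i)) v - pairing E (\<lambda>i. real (w i)) v" for v
    by (simp add: pairing_def left_diff_distrib sum_subtractf)
  show ?thesis
    unfolding l pairing_commute[OF assms, of _ "\<lambda>i. real (w' i) + real (w i)"] pairing_add_left
    using pairing_commute[OF assms] by (simp add: energy_def)
qed

lemma energy_expansion:
  assumes "sym E"
  shows "energy E w' = energy E w + 2 * (\<Sum>i\<in>UNIV. (real (w' i) - real (w i)) * real (\<Sum>j\<in>nbhd E i. w j)) +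
    pairing E (\<lambda>i. real (w' i) - real (w i)) (\<lambda>i. real (w' i) - real (w i))"
  using energy_diff[OF assms, of w' w]
  by (simp add: pairing_def sum.distrib sum_subtractf distrib_left right_diff_distrib left_diff_distrib)

lemma energy_diff_abs_le:
  assumes "sym E"
  shows "\<bar>energy E w' - energy E w\<bar> \<le> (\<Sum>i\<in>UNIV. \<bar>real (w' i) - real (w i)\<bar>) * (total_users w' + total_users w)"
  unfolding energy_diff[OF assms]
  using pairing_abs_le[of E "\<lambda>i. real (w' i) - real (w i)" "\<lambda>i. real (w' i) + real (w i)"]
  by (simp add: total_users_def sum.distrib)

lemma finite_total_le: "finite {w :: 'v::finite state. total_users w \<le> B}"
proof (rule finite_subset)
  show "{w :: 'v state. total_users w \<le> B} \<subseteq> (\<Pi>\<^sub>E i\<in>UNIV. {..nat \<lfloor>B\<rfloor>})"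
    by (auto intro!: le_nat_floor order_trans[OF component_le_total])
  show "finite (\<Pi>\<^sub>E i\<in>(UNIV :: 'v set). {..nat \<lfloor>B\<rfloor>})"
    by (intro finite_PiE) auto
qed

lemma total_update_le: "total_users (update E w \<omega>) \<le> total_users w + total_users (snd \<omega>)"
proof -
  have "total_users (update E w \<omega>) \<le> (\<Sum>i\<in>UNIV. real (w i) + real (snd \<omega> i))"
    unfolding total_users_def by (intro sum_mono) (auto simp: update_def case_prod_unfold)
  then show ?thesis by (simp add: total_users_def sum.distrib)
qed

text \<open>The sum of \<open>A\<close> and the components is at most the number of terms times the
  largest one, and the power of the largest one is among the summands of the bound.\<close>

lemma integrable_total_powr:
  fixes \<mu> :: "'v::finite state pmf"
  assumes s: "0 \<le> s" and A: "0 \<le> A"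
    and moment: "\<And>i. integrable (measure_pmf \<mu>) (\<lambda>a. real (a i) powr s)"
  shows "integrable (measure_pmf \<mu>) (\<lambda>a. (A + total_users a) powr s)"
proof (rule Bochner_Integration.integrable_bound)
  let ?b = "\<lambda>a. real (CARD('v) + 1) powr s * (A powr s + (\<Sum>i\<in>UNIV. real (a i) powr s))"
  show "integrable (measure_pmf \<mu>) ?b"
    using moment by (intro integrable_mult_right Bochner_Integration.integrable_add Bochner_Integration.integrable_sum) auto
  have "(A + total_users a) powr s \<le> ?b a" for a :: "'v state"
  proof -
    define m where "m = Max (insert A (range (\<lambda>i. real (a i))))"
    have Am: "A \<le> m" unfolding m_def by (rule Max_ge) auto
    have am: "real (a i) \<le> m" for i unfolding m_def by (rule Max_ge) auto
    have "m \<in> insert A (range (\<lambda>i. real (a i)))" unfolding m_def by (rule Max_in) auto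
    then have "m powr s \<le> A powr s + (\<Sum>i\<in>UNIV. real (a i) powr s)"
    proof (elim insertE rangeE)
      fix i assume "m = real (a i)"
      then have "m powr s \<le> (\<Sum>i\<in>UNIV. real (a i) powr s)"
        by (auto intro!: member_le_sum[of i UNIV "\<lambda>i. real (a i) powr s"])
      then show ?thesis by (simp add: add_increasing)
    qed (auto intro!: sum_nonneg)
    moreover have "total_users a \<le> real CARD('v) * m"
      unfolding total_users_def using sum_bounded_above[of UNIV "\<lambda>i. real (a i)" m] am by simp
    then have "(A + total_users a) powr s \<le> (real (CARD('v) + 1) * m) powr s"
      using Am A s total_users_nonneg[of a] by (intro powr_mono2) (auto simp: distrib_right)
    moreover have "(real (CARD('v) + 1) * m) powr s = real (CARD('v) + 1) powr s * m powr s"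
      by (rule powr_mult)
    ultimately show ?thesis
      by (smt (verit) mult_left_mono powr_ge_zero)
  qed
  then show "AE a in \<mu>. norm ((A + total_users a) powr s) \<le> norm (?b a)"
    by (auto intro: order_trans[OF _ abs_ge_self])
qed auto

lemma integrable_pair_pmf_fst:
  fixes f :: "'a \<Rightarrow> real"
  assumes "integrable (measure_pmf p) f"
  shows "integrable (measure_pmf (pair_pmf p q)) (\<lambda>z. f (fst z))"
  using assms integrable_map_pmf_eq[of fst "pair_pmf p q" f] by (simp add: map_fst_pair_pmf)

lemma integrable_pair_pmf_snd:
  fixes f :: "'b \<Rightarrow> real"
  assumes "integrable (measure_pmf q) f"
  shows "integrable (measure_pmf (pair_pmf p q)) (\<lambda>z. f (snd z))"
  using assms integrable_map_pmf_eq[of snd "pair_pmf p q" f] by (simp add: map_snd_pair_pmf)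

text \<open>By symmetry each \<open>w j\<close> is counted once for each of its \<open>V\<close>
  neighbours.\<close>

lemma sum_nbhd_sum:
  assumes E: "sym E" and V: "\<And>i. card (nbhd E i) = V"
  shows "(\<Sum>i\<in>UNIV. real (\<Sum>j\<in>nbhd E i. w j)) = real V * total_users w"
proof -
  have "(\<Sum>i\<in>UNIV. real (\<Sum>j\<in>nbhd E i. w j)) = pairing E (\<lambda>_. 1) (\<lambda>i. real (w i))"
    by (simp add: pairing_def)
  also have "\<dots> = pairing E (\<lambda>i. real (w i)) (\<lambda>_. 1)"
    using E by (rule pairing_commute)
  also have "\<dots> = real V * total_users w"
    by (simp add: pairing_def V total_users_def sum_distrib_left mult.commute)
  finally show ?thesis .
qed

lemma expectation_update_diff:
  assumes mean: "has_bochner_integral (measure_pmf \<mu>) (\<lambda>a. real (a i)) r"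
  shows "integrable (measure_pmf (pair_pmf (attempts E w) \<mu>)) (\<lambda>\<omega>. real (update E w \<omega> i) - real (w i))"
    and "measure_pmf.expectation (pair_pmf (attempts E w) \<mu>) (\<lambda>\<omega>. real (update E w \<omega> i) - real (w i)) =
      r - measure_pmf.expectation (attempts E w) (\<lambda>N. real (departure E N i))"
proof -
  let ?P = "measure_pmf (pair_pmf (attempts E w) \<mu>)"
  have a: "integrable (measure_pmf \<mu>) (\<lambda>a. real (a i))" "(\<integral>a. real (a i) \<partial>measure_pmf \<mu>) = r"
    using mean by (auto simp: has_bochner_integral_iff)
  have int_a: "integrable ?P (\<lambda>\<omega>. real (snd \<omega> i))"
    using integrable_pair_pmf_snd[OF a(1)] .
  have int_d: "integrable ?P (\<lambda>\<omega>. real (departure E (fst \<omega>) i))"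
    using departure_le_1 by (intro integrable_pmf_bounded[where B = 1]) auto
  \<comment> \<open>Only almost sure: the truncated subtraction is exact on the support of
    \<open>attempts\<close>.\<close>
  have eq: "AE \<omega> in ?P. real (update E w \<omega> i) - real (w i) = real (snd \<omega> i) - real (departure E (fst \<omega>) i)"
    by (auto simp: AE_measure_pmf_iff real_update)
  show "integrable ?P (\<lambda>\<omega>. real (update E w \<omega> i) - real (w i))"
    using int_a int_d by (subst integrable_cong_AE[OF _ _ eq]) auto
  have "(\<integral>\<omega>. real (update E w \<omega> i) - real (w i) \<partial>?P) = (\<integral>\<omega>. real (snd \<omega> i) - real (departure E (fst \<omega>) i) \<partial>?P)"
    by (rule integral_cong_AE[OF _ _ eq]) auto
  also have "\<dots> = (\<integral>\<omega>. real (snd \<omega> i) \<partial>?P) - (\<integral>\<omega>. real (departure E (fst \<omega>) i) \<partial>?P)"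
    using int_a int_d by (rule Bochner_Integration.integral_diff)
  also have "(\<integral>\<omega>. real (snd \<omega> i) \<partial>?P) = r"
    using a(2) expectation_pair_pmf_snd[of "attempts E w" \<mu> "\<lambda>a. real (a i)"] by simp
  also have "(\<integral>\<omega>. real (departure E (fst \<omega>) i) \<partial>?P) = measure_pmf.expectation (attempts E w) (\<lambda>N. real (departure E N i))"
    using expectation_pair_pmf_fst[of "attempts E w" \<mu> "\<lambda>N. real (departure E N i)"] by simp
  finally show "(\<integral>\<omega>. real (update E w \<omega> i) - real (w i) \<partial>?P) =
      r - measure_pmf.expectation (attempts E w) (\<lambda>N. real (departure E N i))" .
qed

text \<open>The linear term of the expansion weights the mean change at \<open>i\<close> by the
  neighbourhood sum. Arrivals contribute \<open>r * V\<close> per user by regularity; departures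
  contribute nearly exp(-1) per user by the two lower bounds above. The quadratic term has a bounded
  mean.\<close>

lemma energy_drift:
  fixes E :: "('v::finite \<times> 'v) set"
  assumes E: "sym E" and V: "\<And>i. card (nbhd E i) = V" and n: "1 \<le> n"
    and mean: "\<And>i. has_bochner_integral (measure_pmf \<mu>) (\<lambda>a. real (a i)) r"
    and second: "integrable (measure_pmf \<mu>) (\<lambda>a. (total_users a + real CARD('v))\<^sup>2)"
  shows "integrable (measure_pmf (pair_pmf (attempts E w) \<mu>)) (\<lambda>\<omega>. energy E (update E w \<omega>))"
    and "measure_pmf.expectation (pair_pmf (attempts E w) \<mu>) (\<lambda>\<omega>. energy E (update E w \<omega>)) \<le>
      energy E w - 2 * (exp (- 1) * exp (- (real V / real n)) - r * real V) * total_users w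
        + (2 * real CARD('v) * real n + measure_pmf.expectation \<mu> (\<lambda>a. (total_users a + real CARD('v))\<^sup>2))"
proof -
  let ?P = "measure_pmf (pair_pmf (attempts E w) \<mu>)"
  let ?B = "measure_pmf.expectation \<mu> (\<lambda>a. (total_users a + real CARD('v))\<^sup>2)"
  define s where "s i = real (\<Sum>j\<in>nbhd E i. w j)" for i
  define y where "y i = (\<Sum>j\<in>nbhd E i. real (w j) / s j)" for i
  define d where "d i = measure_pmf.expectation (attempts E w) (\<lambda>N. real (departure E N i))" for i
  define \<delta> where "\<delta> i \<omega> = real (update E w \<omega> i) - real (w i)" for i \<omega>
  \<comment> \<open>The quadratic term is replaced by a bound that depends on the arrivals
    alone.\<close>
  define b where "b \<omega> = energy E w + 2 * (\<Sum>i\<in>UNIV. \<delta> i \<omega> * s i) + (total_users (snd \<omega>) + real CARD('v))\<^sup>2" for \<omega>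
  have \<delta>: "integrable ?P (\<delta> i)" "(\<integral>\<omega>. \<delta> i \<omega> \<partial>?P) = r - d i" for i
    unfolding \<delta>_def[abs_def] d_def using expectation_update_diff[OF mean] by auto
  have le_b: "energy E (update E w \<omega>) \<le> b \<omega>" for \<omega>
  proof -
    have "pairing E (\<lambda>i. \<delta> i \<omega>) (\<lambda>i. \<delta> i \<omega>) \<le> (\<Sum>i\<in>UNIV. \<bar>\<delta> i \<omega>\<bar>)\<^sup>2"
      using pairing_abs_le[of E "\<lambda>i. \<delta> i \<omega>" "\<lambda>i. \<delta> i \<omega>"] by (simp add: power2_eq_square)
    also have "\<dots> \<le> (total_users (snd \<omega>) + real CARD('v))\<^sup>2"
      unfolding \<delta>_def by (intro power_mono total_update_diff_le sum_nonneg) auto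
    finally show ?thesis
      using energy_expansion[OF E, of "update E w \<omega>" w] unfolding b_def s_def \<delta>_def by simp
  qed
  have int_sum: "integrable ?P (\<lambda>\<omega>. 2 * (\<Sum>i\<in>UNIV. \<delta> i \<omega> * s i))"
    using \<delta> by (intro integrable_mult_right Bochner_Integration.integrable_sum integrable_mult_left) auto
  have int_sq: "integrable ?P (\<lambda>\<omega>. (total_users (snd \<omega>) + real CARD('v))\<^sup>2)"
    using integrable_pair_pmf_snd[OF second] .
  have int_b: "integrable ?P b"
    unfolding b_def[abs_def] using int_sum int_sq by (intro Bochner_Integration.integrable_add) auto
  show int_energy: "integrable ?P (\<lambda>\<omega>. energy E (update E w \<omega>))"
    by (rule Bochner_Integration.integrable_bound[OF int_b])
       (auto simp: energy_nonneg intro: order_trans[OF le_b abs_ge_self])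
  have "(\<integral>\<omega>. energy E (update E w \<omega>) \<partial>?P) \<le> (\<integral>\<omega>. b \<omega> \<partial>?P)"
    using int_energy int_b le_b by (rule integral_mono)
  also have "\<dots> = energy E w + 2 * (\<Sum>i\<in>UNIV. (r - d i) * s i) + ?B"
  proof -
    have "(\<integral>\<omega>. b \<omega> \<partial>?P) = energy E w + (\<integral>\<omega>. 2 * (\<Sum>i\<in>UNIV. \<delta> i \<omega> * s i) \<partial>?P)
        + (\<integral>\<omega>. (total_users (snd \<omega>) + real CARD('v))\<^sup>2 \<partial>?P)"
      unfolding b_def[abs_def] using int_sum int_sq by simp
    also have "(\<integral>\<omega>. 2 * (\<Sum>i\<in>UNIV. \<delta> i \<omega> * s i) \<partial>?P) = 2 * (\<Sum>i\<in>UNIV. (r - d i) * s i)"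
      using \<delta> by (simp add: Bochner_Integration.integral_sum)
    also have "(\<integral>\<omega>. (total_users (snd \<omega>) + real CARD('v))\<^sup>2 \<partial>?P) = ?B"
      using expectation_pair_pmf_snd[of "attempts E w" \<mu> "\<lambda>a. (total_users a + real CARD('v))\<^sup>2"] by simp
    finally show ?thesis .
  qed
  also have "(\<Sum>i\<in>UNIV. (r - d i) * s i) = r * real V * total_users w - (\<Sum>i\<in>UNIV. s i * d i)"
    using sum_nbhd_sum[OF E V, of w]
    by (simp add: s_def left_diff_distrib sum_subtractf mult.commute mult.assoc flip: sum_distrib_left)
  finally have upper: "(\<integral>\<omega>. energy E (update E w \<omega>) \<partial>?P)
      \<le> energy E w + 2 * (r * real V * total_users w - (\<Sum>i\<in>UNIV. s i * d i)) + ?B" .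
  let ?c = "exp (- (real V / real n))"
  \<comment> \<open>Summing the vertexwise bound loses \<open>n\<close> at every vertex, hence the
    constant \<open>real CARD('v) * real n\<close>.\<close>
  have "?c * (exp (- 1) * total_users w) - real CARD('v) * real n
      \<le> ?c * (\<Sum>i\<in>UNIV. real (w i) * exp (- y i)) - real CARD('v) * real n"
    using sum_exp_lower_bound[OF E, of w] unfolding total_users_def y_def s_def
    by (intro diff_right_mono mult_left_mono) auto
  also have "\<dots> = (\<Sum>i\<in>UNIV. ?c * (real (w i) * exp (- y i)) - real n)"
    by (simp add: sum_subtractf sum_distrib_left)
  also have "\<dots> \<le> (\<Sum>i\<in>UNIV. s i * d i)"
  proof (rule sum_mono)
    show "?c * (real (w i) * exp (- y i)) - real n \<le> s i * d i" for i
      using expectation_departure_lower_bound[OF E n, of i w] unfolding V y_def s_def d_def .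
  qed
  finally have "?c * (exp (- 1) * total_users w) - real CARD('v) * real n \<le> (\<Sum>i\<in>UNIV. s i * d i)" .
  then show "(\<integral>\<omega>. energy E (update E w \<omega>) \<partial>?P) \<le>
      energy E w - 2 * (exp (- 1) * ?c - r * real V) * total_users w + (2 * real CARD('v) * real n + ?B)"
    using upper by (simp add: algebra_simps)
qed

section \<open>The Lyapunov function of a pair\<close>

text \<open>The summand 1 keeps the value at least 1, so that one may divide by it even at the empty
  pair.\<close>

definition pair_norm :: "('v::finite \<times> 'v) set \<Rightarrow> 'v state \<Rightarrow> 'v state \<Rightarrow> real" where
  "pair_norm E x y = sqrt (1 + energy E x + energy E y)"

lemma pair_norm_ge_1: "1 \<le> pair_norm E x y"
  using energy_nonneg[of E x] energy_nonneg[of E y] by (simp add: pair_norm_def)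

lemma pair_norm_le: "pair_norm E x y \<le> 1 + total_users x + total_users y"
  unfolding pair_norm_def
proof (rule real_le_lsqrt)
  show "1 + energy E x + energy E y \<le> (1 + total_users x + total_users y)\<^sup>2"
  proof -
    have expand: "(1 + total_users x + total_users y)\<^sup>2 = 1 + (total_users x)\<^sup>2 + (total_users y)\<^sup>2 + 2 * (total_users x + total_users y + total_users x * total_users y)"
      by (simp add: power2_eq_square algebra_simps)
    have "0 \<le> total_users x + total_users y + total_users x * total_users y"
      by (simp add: total_users_nonneg)
    then show ?thesis
      unfolding expand by (intro add_mono energy_le add_increasing2) auto
  qed
qed (simp add: total_users_nonneg)

lemma total_le_pair_norm:
  fixes x y :: "'v::finite state"
  shows "total_users x + total_users y \<le> 2 * real CARD('v) * pair_norm E x y"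
proof -
  have "total_users w \<le> real CARD('v) * sqrt (energy E w)" for w :: "'v state"
    unfolding total_users_def using sum_bounded_above[of UNIV "\<lambda>i. real (w i)"] component_le_sqrt_energy by fastforce
  moreover have "sqrt (energy E x) \<le> pair_norm E x y" "sqrt (energy E y) \<le> pair_norm E x y"
    using energy_nonneg[of E x] energy_nonneg[of E y] by (auto simp: pair_norm_def)
  ultimately have "total_users x \<le> real CARD('v) * pair_norm E x y" "total_users y \<le> real CARD('v) * pair_norm E x y"
    by (meson mult_left_mono of_nat_0_le_iff order_trans)+
  then show ?thesis by simp
qed

text \<open>Multiply by the sum of the new and old norms: the difference of squares is a difference
  of energies, at most the displacement times the total numbers of users. Those totals are at most a
  multiple of the norms, so the multiplier cancels.\<close>

lemma pair_norm_diff_abs_le: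
  fixes E :: "('v::finite \<times> 'v) set"
  assumes E: "sym E"
  shows "\<bar>pair_norm E x' y' - pair_norm E x y\<bar> \<le> 2 * real CARD('v) *
    ((\<Sum>i\<in>UNIV. \<bar>real (x' i) - real (x i)\<bar>) + (\<Sum>i\<in>UNIV. \<bar>real (y' i) - real (y i)\<bar>))"
proof -
  let ?g = "pair_norm E x y" and ?g' = "pair_norm E x' y'"
  let ?dx = "\<Sum>i\<in>UNIV. \<bar>real (x' i) - real (x i)\<bar>" and ?dy = "\<Sum>i\<in>UNIV. \<bar>real (y' i) - real (y i)\<bar>"
  have dxy: "0 \<le> ?dx" "0 \<le> ?dy" by (auto intro: sum_nonneg)
  have pos: "0 < ?g' + ?g" using pair_norm_ge_1[of E x y] pair_norm_ge_1[of E x' y'] by linarith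
  have sq: "(pair_norm E u v)\<^sup>2 = 1 + energy E u + energy E v" for u v
    using energy_nonneg[of E u] energy_nonneg[of E v] by (simp add: pair_norm_def)
  have "\<bar>?g' - ?g\<bar> * (?g' + ?g) = \<bar>?g'\<^sup>2 - ?g\<^sup>2\<bar>"
    using pos by (simp add: power2_eq_square abs_mult square_diff_square_factored mult.commute)
  also have "\<dots> = \<bar>(energy E x' - energy E x) + (energy E y' - energy E y)\<bar>"
    unfolding sq by simp
  also have "\<dots> \<le> ?dx * (total_users x' + total_users x) + ?dy * (total_users y' + total_users y)"
    using energy_diff_abs_le[OF E, of x' x] energy_diff_abs_le[OF E, of y' y] by linarith
  also have "\<dots> \<le> ?dx * ((total_users x' + total_users y') + (total_users x + total_users y)) + ?dy * ((total_users x' + total_users y') + (total_users x + total_users y))"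
    using dxy total_users_nonneg[of x] total_users_nonneg[of x'] total_users_nonneg[of y] total_users_nonneg[of y']
    by (intro add_mono mult_left_mono) auto
  also have "\<dots> = (?dx + ?dy) * ((total_users x' + total_users y') + (total_users x + total_users y))"
    by (simp add: distrib_right)
  also have "\<dots> \<le> (?dx + ?dy) * (2 * real CARD('v) * ?g' + 2 * real CARD('v) * ?g)"
    using dxy by (intro mult_left_mono add_mono total_le_pair_norm) auto
  also have "\<dots> = 2 * real CARD('v) * (?dx + ?dy) * (?g' + ?g)"
    by (simp add: algebra_simps)
  finally show ?thesis using pos by (simp add: mult_le_cancel_right)
qed

text \<open>Concavity of the square root, in the form of its tangent at the old value; it carries
  the drift of the energies over to the norm.\<close>

lemma pair_norm_diff_le:
  "pair_norm E x' y' - pair_norm E x y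
    \<le> ((energy E x' - energy E x) + (energy E y' - energy E y)) / (2 * pair_norm E x y)"
proof -
  let ?g = "pair_norm E x y" and ?g' = "pair_norm E x' y'"
  have sq: "(pair_norm E u v)\<^sup>2 = 1 + energy E u + energy E v" for u v
    using energy_nonneg[of E u] energy_nonneg[of E v] by (simp add: pair_norm_def)
  have "0 \<le> (?g' - ?g)\<^sup>2" by simp
  then have "(?g' - ?g) * (2 * ?g) \<le> ?g'\<^sup>2 - ?g\<^sup>2"
    by (simp add: power2_eq_square algebra_simps)
  also have "\<dots> = (energy E x' - energy E x) + (energy E y' - energy E y)"
    unfolding sq by simp
  finally show ?thesis using pair_norm_ge_1[of E x y] by (simp add: pos_le_divide_eq)
qed

section \<open>Return to the empty state and conclusion\<close>

text \<open>Irreducibility supplies one time at which the empty state is reached; its loop then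
  keeps the probability positive at all later times.\<close>

lemma empty_recurrent:
  fixes E :: "('v::finite \<times> 'v) set"
  assumes irreducible: "irreducible_chain E \<mu>"
    and no_arrivals: "0 < measure_pmf.prob \<mu> {a. \<forall>i. a i = 0}"
  shows "\<exists>n. \<forall>m\<ge>n. 0 < pmf (iter_pmf (step E \<mu>) x m) (\<lambda>_. 0)"
proof -
  have "{a :: 'v state. \<forall>i. a i = 0} = {\<lambda>_. 0}" by auto
  then have zero: "(\<lambda>_. 0) \<in> set_pmf \<mu>"
    using no_arrivals by (simp add: measure_pmf_single pmf_positive_iff)
  \<comment> \<open>Without arrivals the new state is \<open>0 + 0 - departure\<close>, which is 0
    by truncation.\<close>
  have loop: "(\<lambda>_. 0) \<in> set_pmf (step E \<mu> (\<lambda>_. 0))"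
    using zero set_pmf_not_empty by (fastforce simp: step_def)
  obtain n where n: "0 < pmf (law E \<mu> x n) (\<lambda>_. 0)"
    using irreducible unfolding irreducible_chain_def by blast
  have "(\<lambda>_. 0) \<in> set_pmf (iter_pmf (step E \<mu>) x m)" if "n \<le> m" for m
    using that
  proof (induction m rule: dec_induct)
    case base
    then show ?case using n by (simp add: law_eq_iter pmf_positive_iff)
  next
    case (step m)
    then show ?case using loop by auto
  qed
  then show ?thesis by (auto simp: pmf_positive_iff)
qed

text \<open>Unique existence is part of the conclusion so that one may speak of the stationary
  distribution. The ergodicity criterion is applied with \<open>pair_norm\<close> as
  \<open>G\<close> and the noise of two independent steps.\<close>

theorem theorem6:
  fixes E :: "('v::finite \<times> 'v) set"
    and \<mu> :: "'v state pmf"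
    and rate :: "'v \<Rightarrow> real"
    and r p :: real
    and V :: nat
  assumes graph: "connected_undirected_graph E"
    and mean: "\<And>i. has_bochner_integral (measure_pmf \<mu>) (\<lambda>a. real (a i)) (rate i)"
    and mean_pos: "\<And>i. 0 < rate i"
    and irreducible: "irreducible_chain E \<mu>"
    and symmetric_arrivals: "\<And>i. rate i = r"
    and symmetric_graph: "\<And>i. card (nbhd E i) = V"
    and stability: "r < exp (-1) / real V"
    and p_ge_1: "1 \<le> p"
    and moment: "\<And>i. integrable (measure_pmf \<mu>) (\<lambda>a. real (a i) powr (p + 1))"
    and no_arrivals: "0 < measure_pmf.prob \<mu> {a. \<forall>i. a i = 0}"
  shows "(\<exists>!\<pi>. stationary E \<mu> \<pi>) \<and>
    (\<forall>\<pi> x. stationary E \<mu> \<pi> \<longrightarrow>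
      (\<lambda>n. real n powr p * tv_dist (law E \<mu> x n) \<pi>) \<longlonglongrightarrow> 0)"
proof -
  have E: "sym E" using graph by (simp add: connected_undirected_graph_def)
  have mean_r: "has_bochner_integral (measure_pmf \<mu>) (\<lambda>a. real (a i)) r" for i
    using mean[of i] by (simp add: symmetric_arrivals)
  let ?k = "real CARD('v)"
  have V_pos: "0 < real V"
    using symmetric_graph[of undefined] self_in_nbhd[of undefined E] by (metis card_gt_0_iff empty_iff finite of_nat_0_less_iff)
  have total_moment: "integrable (measure_pmf \<mu>) (\<lambda>a. (A + total_users a) powr (p + 1))" if "0 \<le> A" for A
    using p_ge_1 that moment by (intro integrable_total_powr) auto
  \<comment> \<open>The exponent p + 1 is at least 2 and the base at least 1, so the second moment
    is dominated by the assumed one.\<close>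
  have second: "integrable (measure_pmf \<mu>) (\<lambda>a. (total_users a + ?k)\<^sup>2)"
  proof (rule Bochner_Integration.integrable_bound)
    show "integrable (measure_pmf \<mu>) (\<lambda>a. (?k + total_users a) powr (p + 1))"
      by (intro total_moment) auto
    have "(total_users a + ?k)\<^sup>2 \<le> (?k + total_users a) powr (p + 1)" for a :: "'v state"
    proof -
      have "1 \<le> ?k" by (simp add: Suc_le_eq)
      then have ge1: "1 \<le> ?k + total_users a" using total_users_nonneg[of a] by linarith
      then have "(?k + total_users a) powr 2 \<le> (?k + total_users a) powr (p + 1)"
        using p_ge_1 by (intro powr_mono) auto
      then show ?thesis using ge1 by (simp add: add.commute)
    qed
    then show "AE a in \<mu>. norm ((total_users a + ?k)\<^sup>2) \<le> norm ((?k + total_users a) powr (p + 1))"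
      by simp
  qed auto

  \<comment> \<open>The loss factor of the departure estimate tends to 1, so by strictness of the
    stability condition some \<open>n\<close> leaves a positive gap.\<close>
  have "(\<lambda>n. exp (- 1) * exp (- (real V / real n))) \<longlonglongrightarrow> exp (- 1) * exp (- 0)"
    by (intro tendsto_intros lim_const_over_n)
  moreover have "r * real V < exp (- 1) * exp (- 0)"
    using stability V_pos by (simp add: pos_less_divide_eq)
  ultimately have "\<forall>\<^sub>F n in sequentially. r * real V < exp (- 1) * exp (- (real V / real n))"
    by (rule order_tendstoD(1))
  moreover have "\<forall>\<^sub>F n in sequentially. 1 \<le> (n :: nat)"
    by (rule eventually_ge_at_top)
  ultimately obtain n where n: "1 \<le> n" and gap: "r * real V < exp (- 1) * exp (- (real V / real n))"
    by (metis (mono_tags, lifting) eventually_conj eventually_sequentially order_refl)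
  define c where "c = 2 * (exp (- 1) * exp (- (real V / real n)) - r * real V)"
  define C where "C = 2 * ?k * real n + measure_pmf.expectation \<mu> (\<lambda>a. (total_users a + ?k)\<^sup>2)"
  have c: "0 < c" using gap by (simp add: c_def)
  let ?Q = "\<lambda>w. pair_pmf (attempts E w) \<mu>"
  have energy: "integrable (measure_pmf (?Q w)) (\<lambda>\<omega>. energy E (update E w \<omega>))"
    "measure_pmf.expectation (?Q w) (\<lambda>\<omega>. energy E (update E w \<omega>)) \<le> energy E w - c * total_users w + C" for w
    unfolding c_def C_def using energy_drift[OF E symmetric_graph n mean_r second] by auto

  \<comment> \<open>Beyond \<open>4 * C / c\<close> the two constants \<open>C\<close> use at most
    half of the drift of the energies; beyond 1 the norm is at most twice the total number of
    users.\<close>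
  define T where "T = max 1 (4 * C / c)"
  define D :: "('v state \<times> 'v state) set" where "D = {(x, y). total_users x + total_users y < T}"
  define M where "M x y = pair_pmf (?Q x) (?Q y)" for x y
  define \<Phi> where "\<Phi> x y = map_prod (update E x) (update E y)" for x y
  define \<xi> :: "('v state \<times> 'v state) \<times> ('v state \<times> 'v state) \<Rightarrow> real"
    where "\<xi> \<omega> = 2 * ?k * ((total_users (snd (fst \<omega>)) + ?k) + (total_users (snd (snd \<omega>)) + ?k))" for \<omega>
  \<comment> \<open>\<open>\<xi>\<close> depends on the noise only through the two arrival vectors;
    \<open>h\<close> is that dependence, so the law of \<open>\<xi>\<close> is the same for every
    pair.\<close>
  define h :: "'v state \<times> 'v state \<Rightarrow> real"
    where "h \<omega> = 2 * ?k * ((total_users (fst \<omega>) + ?k) + (total_users (snd \<omega>) + ?k))" for \<omega>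
  have h0: "0 \<le> h \<omega>" for \<omega> by (simp add: h_def total_users_nonneg add_nonneg_nonneg)

  have D: "finite D"
  proof (rule finite_subset)
    show "D \<subseteq> {x. total_users x \<le> T} \<times> {y. total_users y \<le> T}"
    proof
      fix z assume "z \<in> D"
      then show "z \<in> {x. total_users x \<le> T} \<times> {y. total_users y \<le> T}"
        using total_users_nonneg[of "fst z"] total_users_nonneg[of "snd z"] by (auto simp: D_def)
    qed
    show "finite ({x :: 'v state. total_users x \<le> T} \<times> {y :: 'v state. total_users y \<le> T})"
      by (intro finite_cartesian_product finite_total_le)
  qed
  have rep: "pair_pmf (step E \<mu> x) (step E \<mu> y) = map_pmf (\<Phi> x y) (M x y)" for x y
    unfolding step_eq_map M_def \<Phi>_def map_pair[symmetric] by (simp add: map_prod_def)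
  have noise: "map_pmf \<xi> (M x y) = map_pmf h (pair_pmf \<mu> \<mu>)" for x y
  proof -
    have "map_pmf (map_prod snd snd) (M x y) = pair_pmf \<mu> \<mu>"
      unfolding M_def map_prod_def map_pair by (simp add: map_snd_pair_pmf)
    moreover have "\<xi> = h \<circ> map_prod snd snd" by (auto simp: \<xi>_def h_def)
    ultimately show ?thesis by (simp flip: pmf.map_comp)
  qed
  have \<xi>: "0 \<le> \<xi> \<omega>" for \<omega>
    using h0[of "map_prod snd snd \<omega>"] by (simp add: \<xi>_def h_def)
  have moment_h: "integrable (measure_pmf (map_pmf h (pair_pmf \<mu> \<mu>))) (\<lambda>t. (1 + \<bar>t\<bar>) powr (p + 1))"
    unfolding integrable_map_pmf_eq
  proof (rule Bochner_Integration.integrable_bound)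
    let ?A = "1 + 2 * ?k"
    let ?f = "\<lambda>a. (?A + total_users a) powr (p + 1)"
    let ?b = "\<lambda>\<omega>. (4 * ?k) powr (p + 1) * (?f (fst \<omega>) + ?f (snd \<omega>))"
    show "integrable (measure_pmf (pair_pmf \<mu> \<mu>)) ?b"
      using integrable_pair_pmf_fst[OF total_moment[of ?A]] integrable_pair_pmf_snd[OF total_moment[of ?A]]
      by (intro integrable_mult_right Bochner_Integration.integrable_add) auto
    have "(1 + \<bar>h \<omega>\<bar>) powr (p + 1) \<le> ?b \<omega>" for \<omega>
    proof -
      \<comment> \<open>With the larger total \<open>t\<close>, \<open>h\<close> is at most
        \<open>4 * ?k * (?k + t)\<close>, and the power at the maximum is one of the two summands of
        the bound.\<close>
      define t where "t = max (total_users (fst \<omega>)) (total_users (snd \<omega>))"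
      have k1: "1 \<le> ?k" by (simp add: Suc_le_eq)
      have t0: "0 \<le> t" unfolding t_def using total_users_nonneg[of "fst \<omega>"] by (simp add: le_max_iff_disj)
      have "h \<omega> \<le> 2 * ?k * ((t + ?k) + (t + ?k))"
        unfolding h_def t_def by (intro mult_left_mono add_mono) auto
      also have "\<dots> = 4 * ?k * (?k + t)" by (simp add: algebra_simps)
      finally have "1 + \<bar>h \<omega>\<bar> \<le> 1 + 4 * ?k * (?k + t)" using h0[of \<omega>] by simp
      also have "\<dots> \<le> 4 * ?k * (?A + t)"
      proof -
        have "1 * 1 \<le> 4 * ?k * (1 + ?k)" using k1 by (intro mult_mono) linarith+
        then show ?thesis by (simp add: algebra_simps)
      qed
      finally have "(1 + \<bar>h \<omega>\<bar>) powr (p + 1) \<le> (4 * ?k * (?A + t)) powr (p + 1)"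
        using p_ge_1 by (intro powr_mono2) auto
      also have "\<dots> = (4 * ?k) powr (p + 1) * (?A + t) powr (p + 1)" by (rule powr_mult)
      also have "\<dots> \<le> ?b \<omega>"
        by (intro mult_left_mono) (auto simp: t_def max_def)
      finally show ?thesis .
    qed
    then show "AE \<omega> in pair_pmf \<mu> \<mu>. norm ((1 + \<bar>h \<omega>\<bar>) powr (p + 1)) \<le> norm (?b \<omega>)"
      by (auto intro: order_trans[OF _ abs_ge_self])
  qed auto
  have increment: "\<bar>case_prod (pair_norm E) (\<Phi> x y \<omega>) - pair_norm E x y\<bar> \<le> \<xi> \<omega>" for x y \<omega>
  proof -
    have "\<bar>case_prod (pair_norm E) (\<Phi> x y \<omega>) - pair_norm E x y\<bar> \<le> 2 * ?k *
        ((\<Sum>i\<in>UNIV. \<bar>real (update E x (fst \<omega>) i) - real (x i)\<bar>) + (\<Sum>i\<in>UNIV. \<bar>real (update E y (snd \<omega>) i) - real (y i)\<bar>))"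
      using pair_norm_diff_abs_le[OF E] by (simp add: \<Phi>_def case_prod_unfold)
    also have "\<dots> \<le> \<xi> \<omega>"
      unfolding \<xi>_def by (intro mult_left_mono add_mono total_update_diff_le) auto
    finally show ?thesis .
  qed
  have drift: "measure_pmf.expectation (M x y) (\<lambda>\<omega>. case_prod (pair_norm E) (\<Phi> x y \<omega>) - pair_norm E x y) \<le> - (c / 8)"
    if "(x, y) \<notin> D" for x y
  proof -
    let ?P = "measure_pmf (M x y)" and ?g = "pair_norm E x y"
    define t where "t = total_users x + total_users y"
    have t: "1 \<le> t" "4 * C / c \<le> t"
      using that by (auto simp: D_def T_def t_def)
    then have Ct: "4 * C \<le> c * t" using c by (simp add: pos_divide_le_eq mult.commute)
    define f where "f \<omega> = (energy E (update E x (fst \<omega>)) - energy E x) + (energy E (update E y (snd \<omega>)) - energy E y)" for \<omega>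
    have int1: "integrable ?P (\<lambda>\<omega>. energy E (update E x (fst \<omega>)))"
      unfolding M_def using energy(1)[of x] by (rule integrable_pair_pmf_fst)
    have int2: "integrable ?P (\<lambda>\<omega>. energy E (update E y (snd \<omega>)))"
      unfolding M_def using energy(1)[of y] by (rule integrable_pair_pmf_snd)
    have int_f: "integrable ?P f"
      unfolding f_def[abs_def] using int1 int2 by auto
    have E_f: "(\<integral>\<omega>. f \<omega> \<partial>?P) = ((\<integral>\<omega>. energy E (update E x (fst \<omega>)) \<partial>?P) - energy E x) + ((\<integral>\<omega>. energy E (update E y (snd \<omega>)) \<partial>?P) - energy E y)"
      unfolding f_def[abs_def] using int1 int2 by simp
    have "(\<integral>\<omega>. energy E (update E x (fst \<omega>)) \<partial>?P) \<le> energy E x - c * total_users x + C"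
      unfolding M_def using energy(2)[of x] expectation_pair_pmf_fst[of "?Q x" "?Q y" "\<lambda>\<omega>. energy E (update E x \<omega>)"] by simp
    moreover have "(\<integral>\<omega>. energy E (update E y (snd \<omega>)) \<partial>?P) \<le> energy E y - c * total_users y + C"
      unfolding M_def using energy(2)[of y] expectation_pair_pmf_snd[of "?Q x" "?Q y" "\<lambda>\<omega>. energy E (update E y \<omega>)"] by simp
    ultimately have f_le: "(\<integral>\<omega>. f \<omega> \<partial>?P) \<le> - (c * t / 2)"
      using Ct unfolding E_f t_def distrib_left by argo
    have g: "0 < ?g" "?g \<le> 2 * t"
      using pair_norm_ge_1[of E x y] pair_norm_le[of E x y] t(1) by (auto simp: t_def)
    have "integrable ?P (\<lambda>\<omega>. case_prod (pair_norm E) (\<Phi> x y \<omega>) - ?g)"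
    proof (rule Bochner_Integration.integrable_bound)
      show "integrable ?P (\<lambda>\<omega>. 1 + energy E (update E x (fst \<omega>)) + energy E (update E y (snd \<omega>)) + ?g)"
        using int1 int2 by auto
      \<comment> \<open>For integrability alone the crude estimate sqrt z \<le> z for z \<ge> 1
        suffices.\<close>
      have bound: "\<bar>case_prod (pair_norm E) (\<Phi> x y \<omega>) - ?g\<bar>
          \<le> 1 + energy E (update E x (fst \<omega>)) + energy E (update E y (snd \<omega>)) + ?g" for \<omega>
      proof -
        have "sqrt (1 + energy E u + energy E v) \<le> 1 + energy E u + energy E v" for u v
          using energy_nonneg[of E u] energy_nonneg[of E v]
          by (intro real_le_lsqrt) (auto simp: power2_eq_square algebra_simps add_nonneg_nonneg)
        then have "pair_norm E u v \<le> 1 + energy E u + energy E v" for u v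
          by (simp add: pair_norm_def)
        moreover have "1 \<le> pair_norm E u v" for u v by (rule pair_norm_ge_1)
        ultimately show ?thesis using g(1)
          by (smt (verit) \<Phi>_def case_prod_unfold fst_map_prod snd_map_prod)
      qed
      show "AE \<omega> in ?P. norm (case_prod (pair_norm E) (\<Phi> x y \<omega>) - ?g)
          \<le> norm (1 + energy E (update E x (fst \<omega>)) + energy E (update E y (snd \<omega>)) + ?g)"
        unfolding real_norm_def by (intro AE_I2 order_trans[OF bound abs_ge_self])
    qed auto
    then have "(\<integral>\<omega>. case_prod (pair_norm E) (\<Phi> x y \<omega>) - ?g \<partial>?P) \<le> (\<integral>\<omega>. f \<omega> / (2 * ?g) \<partial>?P)"
    proof (rule integral_mono)
      show "integrable ?P (\<lambda>\<omega>. f \<omega> / (2 * ?g))"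
        using int_f by (intro integrable_divide) auto
      show "case_prod (pair_norm E) (\<Phi> x y \<omega>) - ?g \<le> f \<omega> / (2 * ?g)" for \<omega>
        using pair_norm_diff_le[of E _ _ x y] by (simp add: f_def \<Phi>_def case_prod_unfold)
    qed
    also have "\<dots> = (\<integral>\<omega>. f \<omega> \<partial>?P) / (2 * ?g)" by simp
    also have "\<dots> \<le> - (c * t / 2) / (2 * ?g)"
      using f_le g by (intro divide_right_mono) auto
    \<comment> \<open>The norm is at most \<open>2 * t\<close>, so \<open>t\<close> cancels: the
      energy drift grows linearly and the divisor at most linearly.\<close>
    also have "\<dots> \<le> - (c / 8)"
    proof -
      have "c * ?g \<le> c * (2 * t)" using g c by (intro mult_left_mono) auto
      then show ?thesis using g c by (simp add: field_simps)
    qed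
    finally show ?thesis .
  qed
  have step_moment: "integrable (measure_pmf (step E \<mu> x)) (\<lambda>y. (1 + pair_norm E x y) powr (p + 1))" for x
    unfolding step_eq_map integrable_map_pmf_eq
  proof (rule Bochner_Integration.integrable_bound)
    \<comment> \<open>One unit from the integrand and one from \<open>pair_norm_le\<close>;
      \<open>x\<close> is counted once for itself and once in its successor.\<close>
    let ?A = "2 + 2 * total_users x"
    show "integrable (measure_pmf (?Q x)) (\<lambda>\<omega>. (?A + total_users (snd \<omega>)) powr (p + 1))"
      by (intro integrable_pair_pmf_snd total_moment) (simp add: total_users_nonneg)
    have "1 + pair_norm E x (update E x \<omega>) \<le> ?A + total_users (snd \<omega>)" for \<omega>
      using pair_norm_le[of E x "update E x \<omega>"] total_update_le[of E x \<omega>] by linarith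
    then have "(1 + pair_norm E x (update E x \<omega>)) powr (p + 1) \<le> (?A + total_users (snd \<omega>)) powr (p + 1)" for \<omega>
      using p_ge_1 pair_norm_ge_1[of E x "update E x \<omega>"] by (intro powr_mono2) auto
    then show "AE \<omega> in ?Q x. norm ((1 + pair_norm E x (update E x \<omega>)) powr (p + 1)) \<le> norm ((?A + total_users (snd \<omega>)) powr (p + 1))"
      by auto
  qed auto
  have c8: "0 < c / 8" using c by simp
  have G0: "0 \<le> pair_norm E x y" for x y
    using pair_norm_ge_1[of E x y] by linarith
  note ergodic = polynomial_ergodicity_of_drift[OF p_ge_1 c8 D G0 rep noise \<xi> moment_h increment drift step_moment
      empty_recurrent[OF irreducible no_arrivals]]
  show ?thesis
    unfolding stationary_def law_eq_iter using ergodic by blast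
qed

end
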